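(* Let $\bm U_1,\bm U_2,\dots$ be independent copies of a random vector $\bm U\in\mathbb R^d$ following a copula $C$. Suppose that $C\in\mathcal D(G)$ with $G(\bm x)=\exp(-\|\bm x\|_D)$, $\bm x\le\bm 0\in\mathbb R^d$, where $\|\cdot\|_D$ is a $D$-norm on $\mathbb R^d$. Let $\bm\eta$ be a random vector with distribution function $G$. Then $$n\,\underline{\pi}_n(\bm U)\longrightarrow E\left(\|\bm\eta\|_D\right)\qquad(n\to\infty),$$ and, for every $\bm x\le\bm 0\in\mathbb R^d$, $$P\big(n(\bm U_n-\bm 1)\le\bm x\mid \bm U_n\text{ is a simple record}\big)\longrightarrow H_D(\bm x):=\frac{E(\|\min(\bm x,\bm\eta)\|_D)-\|\bm x\|_D}{E(\|\bm\eta\|_D)}\qquad(n\to\infty).$$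
   Context: All operations and relations on vectors ($\max$, $\min$, $\le$, ...) are componentwise; $\bm 1=(1,\dots,1)$. $\|\cdot\|_D$ is a $D$-norm on $\mathbb R^d$ if there is a random vector $\bm Z=(Z_1,\dots,Z_d)\ge\bm 0$ with $E(Z_j)=1$, $1\le j\le d$, such that $\|\bm x\|_D=E(\max_{1\le j\le d}|x_j|Z_j)$ for $\bm x\in\mathbb R^d$; then $G(\bm x)=\exp(-\|\bm x\|_D)$, $\bm x\le\bm 0$, is a standard max-stable distribution function on $\mathbb R^d$ (its margins are standard negative exponential). A copula is a distribution function on $\mathbb R^d$ whose univariate margins are uniform on $(0,1)$. $C\in\mathcal D(G)$ means $C^n(\bm 1+\bm x/n)\to_{n\to\infty}G(\bm x)$ for all $\bm x\le\bm 0$. $\bm U_n$ is a simple record if $\bm U_n\not\le\max_{1\le i\le n-1}\bm U_i$, i.e. at least one component of $\bm U_n$ exceeds the corresponding components of all of $\bm U_1,\dots,\bm U_{n-1}$; $\underline{\pi}_n(\bm U):=P(\bm U_n\text{ is a simple record})$ (with $\underline{\pi}_1(\bm U):=1$). *)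

theory Defs
  imports "HOL-Probability.Probability"
begin

definition has_df :: "'a measure \<Rightarrow> ('a \<Rightarrow> real ^ 'd) \<Rightarrow> (real ^ 'd \<Rightarrow> real) \<Rightarrow> bool" where
  "has_df M X F \<longleftrightarrow> X \<in> borel_measurable M \<and> (\<forall>x. \<P>(\<omega> in M. X \<omega> \<le> x) = F x)"

text \<open>
  The random vectors required to exist in the next two definitions are represented by their
  laws \<open>\<zeta>\<close> and \<open>\<mu>\<close> on \<open>\<real>\<^sup>d\<close>; the lemmas \<open>D_normI\<close> and \<open>copulaI\<close> show that
  random vectors on arbitrary probability spaces give nothing more.
\<close>

definition D_norm :: "(real ^ 'd \<Rightarrow> real) \<Rightarrow> bool" where
  "D_norm D \<longleftrightarrow> (\<exists>\<zeta> :: (real ^ 'd) measure. prob_space \<zeta> \<and> sets \<zeta> = sets borel \<and>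
     (AE z in \<zeta>. 0 \<le> z) \<and>
     (\<forall>j. has_bochner_integral \<zeta> (\<lambda>z. z $ j) 1) \<and>
     (\<forall>x. D x = (\<integral>z. (MAX j. \<bar>x $ j\<bar> * z $ j) \<partial>\<zeta>)))"

definition copula :: "(real ^ 'd \<Rightarrow> real) \<Rightarrow> bool" where
  "copula C \<longleftrightarrow> (\<exists>\<mu> :: (real ^ 'd) measure. prob_space \<mu> \<and> sets \<mu> = sets borel \<and>
     has_df \<mu> (\<lambda>u. u) C \<and>
     (\<forall>j. distr \<mu> borel (\<lambda>u. u $ j) = uniform_measure lborel {0<..<1}))"

lemma D_normI:
  fixes Z :: "'a \<Rightarrow> real ^ 'd"
  assumes "prob_space N" and Z [measurable]: "Z \<in> borel_measurable N"
    and "AE \<omega> in N. 0 \<le> Z \<omega>"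
    and "\<And>j. has_bochner_integral N (\<lambda>\<omega>. Z \<omega> $ j) 1"
    and "\<And>x. D x = (\<integral>\<omega>. (MAX j. \<bar>x $ j\<bar> * Z \<omega> $ j) \<partial>N)"
  shows "D_norm D"
proof -
  have comp [measurable]: "(\<lambda>z::real^'d. z $ j) \<in> borel_measurable borel" for j
    by (intro borel_measurable_continuous_onI continuous_intros)
  have [measurable]: "(\<lambda>z::real^'d. MAX j. \<bar>x $ j\<bar> * z $ j) \<in> borel_measurable borel" for x :: "real^'d"
    by (rule borel_measurable_Max) auto
  have 1: "has_bochner_integral (distr N borel Z) (\<lambda>z. z $ j) 1" for j
    using assms(4)[of j] by (simp add: has_bochner_integral_distr[OF comp Z])
  have 2: "AE z in distr N borel Z. 0 \<le> z"
    using assms(3) by (subst AE_distr_iff) (auto simp: less_eq_vec_def)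
  show ?thesis unfolding D_norm_def
    by (rule exI[of _ "distr N borel Z"])
       (use 1 2 in \<open>auto simp: assms(5) integral_distr prob_space.prob_space_distr[OF assms(1)]\<close>)
qed

lemma copulaI:
  fixes U :: "'a \<Rightarrow> real ^ 'd"
  assumes "prob_space N" and "has_df N U C"
    and "\<And>j. distr N borel (\<lambda>\<omega>. U \<omega> $ j) = uniform_measure lborel {0<..<1}"
  shows "copula C"
proof -
  have U [measurable]: "U \<in> borel_measurable N"
    using assms(2) by (simp add: has_df_def)
  have comp [measurable]: "(\<lambda>z::real^'d. z $ j) \<in> borel_measurable borel" for j
    by (intro borel_measurable_continuous_onI continuous_intros)
  have "measure (distr N borel U) {u. u \<le> x} = C x" for x
    using assms(2) by (subst measure_distr) (auto simp: has_df_def vimage_def Int_def conj_commute less_eq_vec_def)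
  then have "has_df (distr N borel U) (\<lambda>u. u) C"
    by (simp add: has_df_def)
  moreover have "distr (distr N borel U) borel (\<lambda>u. u $ j) = uniform_measure lborel {0<..<1}" for j
    by (simp add: distr_distr comp_def assms(3))
  ultimately show ?thesis unfolding copula_def
    by (intro exI[of _ "distr N borel U"]) (auto simp: prob_space.prob_space_distr[OF assms(1)])
qed

text \<open>
  \<open>exp (- D x)\<close> for \<open>x \<le> 0\<close>, continued to a distribution function on the whole of \<open>\<real>\<^sup>d\<close>
  (which has all its mass on \<open>x \<le> 0\<close>); \<open>inf\<close> is the componentwise minimum.
\<close>

definition max_stable_df :: "(real ^ 'd \<Rightarrow> real) \<Rightarrow> real ^ 'd \<Rightarrow> real" where
  "max_stable_df D x = exp (- D (inf x 0))"

definition max_domain :: "(real ^ 'd \<Rightarrow> real) \<Rightarrow> (real ^ 'd \<Rightarrow> real) set" where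
  "max_domain G = {C. \<forall>x\<le>0. (\<lambda>n. C (1 + x /\<^sub>R real n) ^ n) \<longlonglongrightarrow> G x}"

text \<open>Sequences are indexed from 1, so the first observation is a record.\<close>

definition simple_record :: "(nat \<Rightarrow> 'a \<Rightarrow> real ^ 'd) \<Rightarrow> nat \<Rightarrow> 'a \<Rightarrow> bool" where
  "simple_record U n \<omega> \<longleftrightarrow> (\<exists>j. \<forall>i\<in>{1..<n}. U i \<omega> $ j < U n \<omega> $ j)"

lemma simple_record_iff_not_le_Max:
  assumes "n \<ge> 2"
  shows "simple_record U n \<omega> \<longleftrightarrow> \<not> U n \<omega> \<le> (\<chi> j. MAX i\<in>{1..<n}. U i \<omega> $ j)"
  using assms by (simp add: simple_record_def less_eq_vec_def not_le)

definition simple_record_prob :: "'a measure \<Rightarrow> (nat \<Rightarrow> 'a \<Rightarrow> real ^ 'd) \<Rightarrow> nat \<Rightarrow> real" where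
  "simple_record_prob M U n = \<P>(\<omega> in M. simple_record U n \<omega>)"

end

theory Submission imports Defs begin

text \<open>
  Let \<open>W\<close> be the componentwise maximum of the first \<open>n - 1\<close> observations, \<open>Y = n (W - 1)\<close> and
  \<open>h(y) = n (1 - C (1 + y / n))\<close>. Conditioning on \<open>W\<close>, which is independent of the \<open>n\<close>-th
  observation, \<open>n\<close> times the probability that the latter is a record and lies below \<open>1 + x / n\<close> is
  \<open>E (h (min x Y)) - h x\<close>; the case \<open>x = 0\<close> is the record probability itself. Since the margins of
  \<open>C\<close> are uniform, all the functions \<open>h\<close> are Lipschitz with constant 1 for the sum norm, so that
  \<open>h \<longlonglongrightarrow> D\<close> uniformly on boxes, and the exponential tails of \<open>Y\<close> allow replacing \<open>h\<close> by \<open>D\<close>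
  under the expectation. Finally \<open>E (D (min x Y))\<close> is an integral, over the generator \<open>z\<close> of \<open>D\<close>
  and levels \<open>t > 0\<close>, of probabilities of complements of orthants for \<open>Y\<close>. These converge by
  inclusion-exclusion from the convergence of distribution functions, and dominated convergence
  applies; no general theory of weak convergence in several dimensions is needed.
\<close>

section \<open>Measurability, tails and layer cakes\<close>

lemma borel_measurable_vec_lambda [measurable (raw)]:
  assumes [measurable]: "\<And>j. f j \<in> borel_measurable M"
  shows "(\<lambda>\<omega>. (\<chi> j. f j \<omega>) :: real ^ 'd) \<in> borel_measurable M"
proof (subst borel_measurable_euclidean_space, rule ballI)
  fix i :: "real ^ 'd" assume "i \<in> Basis"
  then obtain j where "i = axis j 1" by (auto simp: Basis_vec_def)
  then show "(\<lambda>\<omega>. (\<chi> j. f j \<omega>) \<bullet> i) \<in> borel_measurable M" by (simp add: inner_axis)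
qed

lemma borel_measurable_vec_component [measurable (raw)]:
  assumes [measurable]: "f \<in> borel_measurable M"
  shows "(\<lambda>\<omega>. (f \<omega> :: real ^ 'd) $ j) \<in> borel_measurable M"
proof -
  have [measurable]: "(\<lambda>z::real^'d. z $ j) \<in> borel_measurable borel"
    by (intro borel_measurable_continuous_onI continuous_intros)
  show ?thesis by measurable
qed

lemma borel_measurable_inf_vec [measurable (raw)]:
  assumes [measurable]: "f \<in> borel_measurable M" "g \<in> borel_measurable M"
  shows "(\<lambda>\<omega>. inf (f \<omega>) (g \<omega> :: real ^ 'd)) \<in> borel_measurable M"
  unfolding inf_vec_def inf_min by measurable

lemma pred_vec_le [measurable (raw)]:
  assumes [measurable]: "f \<in> borel_measurable M" "g \<in> borel_measurable M"
  shows "Measurable.pred M (\<lambda>\<omega>. f \<omega> \<le> (g \<omega> :: real ^ 'd))"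
  unfolding less_eq_vec_def by measurable

text \<open>Tonelli's theorem on the region under the graph. \<open>ennreal\<close> truncates
  negative values to 0, which matches the restriction to \<open>t > 0\<close>, so signed functions
  such as an excess \<open>- X - R\<close> can be inserted directly.\<close>

lemma nn_integral_layer_cake:
  fixes f :: "'a \<Rightarrow> real"
  assumes "sigma_finite_measure M" and [measurable]: "f \<in> borel_measurable M"
  shows "(\<integral>\<^sup>+\<omega>. ennreal (f \<omega>) \<partial>M) =
    (\<integral>\<^sup>+t. emeasure M {\<omega> \<in> space M. t \<le> f \<omega>} * indicator {0<..} t \<partial>lborel)"
proof -
  interpret M: sigma_finite_measure M by fact
  interpret pair_sigma_finite M "lborel :: real measure" ..
  have "(\<integral>\<^sup>+\<omega>. ennreal (f \<omega>) \<partial>M) = (\<integral>\<^sup>+\<omega>. emeasure lborel {0<..f \<omega>} \<partial>M)"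
  proof (rule nn_integral_cong)
    show "ennreal (f \<omega>) = emeasure lborel {0<..f \<omega>}" for \<omega>
      by (cases "0 \<le> f \<omega>") (simp_all add: ennreal_neg)
  qed
  also have "\<dots> = (\<integral>\<^sup>+\<omega>. \<integral>\<^sup>+t. indicator {p. 0 < snd p \<and> snd p \<le> f (fst p)} (\<omega>, t) \<partial>lborel \<partial>M)"
  proof (rule nn_integral_cong)
    fix \<omega>
    have "emeasure lborel {0<..f \<omega>} = (\<integral>\<^sup>+t. indicator {0<..f \<omega>} t \<partial>lborel)" by simp
    also have "\<dots> = (\<integral>\<^sup>+t. indicator {p. 0 < snd p \<and> snd p \<le> f (fst p)} (\<omega>, t) \<partial>lborel)"
      by (intro nn_integral_cong) (simp split: split_indicator)
    finally show "emeasure lborel {0<..f \<omega>} =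
      (\<integral>\<^sup>+t. indicator {p. 0 < snd p \<and> snd p \<le> f (fst p)} (\<omega>, t) \<partial>lborel)" .
  qed
  also have "\<dots> = (\<integral>\<^sup>+t. \<integral>\<^sup>+\<omega>. indicator {p. 0 < snd p \<and> snd p \<le> f (fst p)} (\<omega>, t) \<partial>M \<partial>lborel)"
    by (intro Fubini'[symmetric]) measurable
  also have "\<dots> = (\<integral>\<^sup>+t. emeasure M {\<omega> \<in> space M. t \<le> f \<omega>} * indicator {0<..} t \<partial>lborel)"
  proof (rule nn_integral_cong)
    fix t :: real
    have "(\<integral>\<^sup>+\<omega>. indicator {p. 0 < snd p \<and> snd p \<le> f (fst p)} (\<omega>, t) \<partial>M) =
      (\<integral>\<^sup>+\<omega>. indicator {\<omega> \<in> space M. t \<le> f \<omega>} \<omega> * indicator {0<..} t \<partial>M)"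
      by (intro nn_integral_cong) (auto split: split_indicator)
    then show "(\<integral>\<^sup>+\<omega>. indicator {p. 0 < snd p \<and> snd p \<le> f (fst p)} (\<omega>, t) \<partial>M) =
      emeasure M {\<omega> \<in> space M. t \<le> f \<omega>} * indicator {0<..} t"
      by (simp add: nn_integral_multc)
  qed
  finally show ?thesis .
qed

lemma nn_integral_exp_tail:
  fixes c R :: real
  assumes "0 < c"
  shows "(\<integral>\<^sup>+t. ennreal (exp (- ((t + R) / c))) * indicator {0<..} t \<partial>lborel) = ennreal (c * exp (- (R / c)))"
proof -
  have "(\<integral>\<^sup>+t. ennreal (exp (- ((t + R) / c))) * indicator {0<..} t \<partial>lborel) =
    (\<integral>\<^sup>+t. ennreal (exp (- ((t + R) / c))) * indicator {0..} t \<partial>lborel)"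
  proof (rule nn_integral_cong_AE)
    show "AE t in lborel. ennreal (exp (- ((t + R) / c))) * indicator {0<..} t =
      ennreal (exp (- ((t + R) / c))) * indicator {0..} t"
      using AE_lborel_singleton[of 0] by eventually_elim (simp split: split_indicator)
  qed
  also have "\<dots> = ennreal (0 - (- c * exp (- ((0 + R) / c))))"
  proof (rule nn_integral_FTC_atLeast)
    have "LIM t at_top. (t + R) / c :> at_top"
      using assms by real_asymp
    then have "((\<lambda>t. exp (- ((t + R) / c))) \<longlongrightarrow> 0) at_top"
      by (intro filterlim_compose[OF exp_at_bot] filterlim_compose[OF filterlim_uminus_at_bot_at_top])
    then show "((\<lambda>t. - c * exp (- ((t + R) / c))) \<longlongrightarrow> 0) at_top"
      by (rule tendsto_mult_right_zero)
    show "((\<lambda>t. - c * exp (- ((t + R) / c))) has_real_derivative exp (- ((t + R) / c))) (at t)" for t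
      using assms by (auto intro!: derivative_eq_intros)
  qed auto
  finally show ?thesis by simp
qed

text \<open>Quantitative uniform integrability from an exponential lower tail: \<open>R = 0\<close>
  yields integrability, and large \<open>R\<close> makes the mass beyond the level \<open>R\<close>
  small at a rate that depends only on \<open>c\<close>.\<close>

lemma nn_integral_excess_le:
  fixes X :: "'a \<Rightarrow> real"
  assumes "prob_space M" and [measurable]: "X \<in> borel_measurable M"
    and tail: "\<And>t. t \<ge> 0 \<Longrightarrow> measure M {\<omega> \<in> space M. X \<omega> \<le> - t} \<le> exp (- (t / c))"
    and "0 < c" "0 \<le> R"
  shows "(\<integral>\<^sup>+\<omega>. ennreal (- X \<omega> - R) \<partial>M) \<le> ennreal (c * exp (- (R / c)))"
proof -
  interpret prob_space M by fact
  have "(\<integral>\<^sup>+\<omega>. ennreal (- X \<omega> - R) \<partial>M) =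
    (\<integral>\<^sup>+t. emeasure M {\<omega> \<in> space M. t \<le> - X \<omega> - R} * indicator {0<..} t \<partial>lborel)"
    by (intro nn_integral_layer_cake) (auto intro: sigma_finite_measure)
  also have "\<dots> \<le> (\<integral>\<^sup>+t. ennreal (exp (- ((t + R) / c))) * indicator {0<..} t \<partial>lborel)"
  proof (rule nn_integral_mono)
    fix t :: real
    have "{\<omega> \<in> space M. t \<le> - X \<omega> - R} = {\<omega> \<in> space M. X \<omega> \<le> - (t + R)}" by auto
    then show "emeasure M {\<omega> \<in> space M. t \<le> - X \<omega> - R} * indicator {0<..} t
      \<le> ennreal (exp (- ((t + R) / c))) * indicator {0<..} t"
      using tail[of "t + R"] \<open>0 \<le> R\<close>
      by (auto simp: emeasure_eq_measure ennreal_leI split: split_indicator)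
  qed
  also have "\<dots> = ennreal (c * exp (- (R / c)))"
    by (rule nn_integral_exp_tail) fact
  finally show ?thesis .
qed

lemma (in prob_space) prob_le_add_sum:
  assumes [measurable]: "Measurable.pred M P" "Measurable.pred M Q"
    and fin: "finite I" and [measurable]: "\<And>i. i \<in> I \<Longrightarrow> Measurable.pred M (R i)"
    and "\<And>\<omega>. \<omega> \<in> space M \<Longrightarrow> P \<omega> \<Longrightarrow> Q \<omega> \<or> (\<exists>i\<in>I. R i \<omega>)"
  shows "\<P>(\<omega> in M. P \<omega>) \<le> \<P>(\<omega> in M. Q \<omega>) + (\<Sum>i\<in>I. \<P>(\<omega> in M. R i \<omega>))"
proof -
  have sets: "(\<Union>i\<in>I. {\<omega> \<in> space M. R i \<omega>}) \<in> sets M"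
    using fin by (intro sets.finite_UN) measurable
  have "\<P>(\<omega> in M. P \<omega>) \<le> measure M ({\<omega> \<in> space M. Q \<omega>} \<union> (\<Union>i\<in>I. {\<omega> \<in> space M. R i \<omega>}))"
    using assms(5) sets by (intro finite_measure_mono) auto
  also have "\<dots> \<le> \<P>(\<omega> in M. Q \<omega>) + measure M (\<Union>i\<in>I. {\<omega> \<in> space M. R i \<omega>})"
    using sets by (intro measure_Un_le) auto
  also have "measure M (\<Union>i\<in>I. {\<omega> \<in> space M. R i \<omega>}) \<le> (\<Sum>i\<in>I. \<P>(\<omega> in M. R i \<omega>))"
    using fin by (intro finite_measure_subadditive_finite) auto
  finally show ?thesis by simp
qed

lemma borel_measurable_of_lipschitz:
  fixes f :: "real ^ 'd \<Rightarrow> real"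
  assumes "\<And>x y. \<bar>f x - f y\<bar> \<le> L * (\<Sum>j\<in>UNIV. \<bar>x $ j - y $ j\<bar>)"
  shows "f \<in> borel_measurable borel"
proof (intro borel_measurable_continuous_onI)
  have "((\<lambda>x. f x - f y) \<longlongrightarrow> 0) (at y)" for y
  proof (rule Lim_null_comparison)
    show "eventually (\<lambda>x. norm (f x - f y) \<le> L * (\<Sum>j\<in>UNIV. \<bar>x $ j - y $ j\<bar>)) (at y)"
      using assms by simp
    have "((\<lambda>x. L * (\<Sum>j\<in>UNIV. \<bar>x $ j - y $ j\<bar>)) \<longlongrightarrow> L * (\<Sum>j\<in>UNIV. \<bar>y $ j - y $ j\<bar>)) (at y)"
      by (intro tendsto_intros)
    then show "((\<lambda>x. L * (\<Sum>j\<in>UNIV. \<bar>x $ j - y $ j\<bar>)) \<longlongrightarrow> 0) (at y)" by simp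
  qed
  then show "continuous_on UNIV f"
    by (auto simp: continuous_on_def LIM_zero_iff)
qed

text \<open>A maximum reaches \<open>t\<close> iff one of its terms does. For nonpositive
  \<open>x\<close> and \<open>v\<close>, \<open>\<bar>inf x v $ j\<bar>\<close> is the larger of
  \<open>\<bar>x $ j\<bar>\<close> and \<open>- v $ j\<close>, so either the deterministic vector
  \<open>x\<close> reaches \<open>t\<close> or some \<open>v $ j\<close> falls to
  \<open>- (t / z $ j)\<close>. The latter is the complement of an orthant event; components with
  \<open>z $ j = 0\<close> never reach \<open>t > 0\<close>.\<close>

lemma (in prob_space) prob_Max_inf_ge:
  fixes V :: "'a \<Rightarrow> real ^ 'd" and x z :: "real ^ 'd"
  assumes [measurable]: "V \<in> borel_measurable M" and V: "AE \<omega> in M. V \<omega> \<le> 0"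
    and "x \<le> 0" "0 \<le> z" "0 < t"
  shows "\<P>(\<omega> in M. t \<le> (MAX j. \<bar>inf x (V \<omega>) $ j\<bar> * z $ j)) =
    (if \<exists>j. t \<le> \<bar>x $ j\<bar> * z $ j then 1
     else 1 - \<P>(\<omega> in M. \<forall>j\<in>{j. 0 < z $ j}. - (t / z $ j) < V \<omega> $ j))"
proof -
  have z: "0 \<le> z $ j" for j using \<open>0 \<le> z\<close> by (simp add: less_eq_vec_def)
  have x: "x $ j \<le> 0" for j using \<open>x \<le> 0\<close> by (simp add: less_eq_vec_def)
  have ge_iff: "t \<le> (MAX j. \<bar>inf x v $ j\<bar> * z $ j) \<longleftrightarrow> (\<exists>j. t \<le> \<bar>inf x v $ j\<bar> * z $ j)" for v
    by (subst Max_ge_iff) auto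
  have coord: "t \<le> \<bar>inf x v $ j\<bar> * z $ j \<longleftrightarrow>
      t \<le> \<bar>x $ j\<bar> * z $ j \<or> (0 < z $ j \<and> v $ j \<le> - (t / z $ j))" if "v \<le> 0" for v j
  proof (cases "z $ j = 0")
    case False
    with z[of j] have "0 < z $ j" by simp
    have "v $ j \<le> 0" using that by (simp add: less_eq_vec_def)
    with x[of j] have "\<bar>inf x v $ j\<bar> = max \<bar>x $ j\<bar> (- v $ j)"
      by (simp add: inf_vec_def inf_real_def min_def max_def)
    then show ?thesis
      using \<open>0 < z $ j\<close> by (simp add: max_mult_distrib_right le_max_iff_disj) (auto simp: field_simps)
  qed (use \<open>0 < t\<close> in auto)
  show ?thesis
  proof (cases "\<exists>j. t \<le> \<bar>x $ j\<bar> * z $ j")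
    case True
    then have "\<P>(\<omega> in M. t \<le> (MAX j. \<bar>inf x (V \<omega>) $ j\<bar> * z $ j)) = 1"
      using V by (subst prob_Collect_eq_1) (auto simp: ge_iff coord elim!: eventually_mono)
    with True show ?thesis by simp
  next
    case False
    have "\<P>(\<omega> in M. t \<le> (MAX j. \<bar>inf x (V \<omega>) $ j\<bar> * z $ j)) =
        \<P>(\<omega> in M. \<not> (\<forall>j\<in>{j. 0 < z $ j}. - (t / z $ j) < V \<omega> $ j))"
    proof (rule prob_eq_AE)
      show "AE \<omega> in M. t \<le> (MAX j. \<bar>inf x (V \<omega>) $ j\<bar> * z $ j) \<longleftrightarrow>
          \<not> (\<forall>j\<in>{j. 0 < z $ j}. - (t / z $ j) < V \<omega> $ j)"
        using V
      proof eventually_elim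
        case (elim \<omega>)
        then show ?case using False by (auto simp: ge_iff coord not_less simp del: Max_ge_iff)
      qed
    qed measurable
    also have "\<dots> = 1 - \<P>(\<omega> in M. \<forall>j\<in>{j. 0 < z $ j}. - (t / z $ j) < V \<omega> $ j)"
      by (intro prob_neg) measurable
    finally show ?thesis using False by auto
  qed
qed

section \<open>D-norms\<close>

locale D_norm_generator = prob_space \<zeta>
  for \<zeta> :: "(real ^ 'd) measure" +
  fixes D :: "real ^ 'd \<Rightarrow> real"
  assumes sets_generator [measurable_cong]: "sets \<zeta> = sets borel"
    and generator_nonneg: "AE z in \<zeta>. 0 \<le> z"
    and generator_mean: "has_bochner_integral \<zeta> (\<lambda>z. z $ j) 1"
    and D_eq: "D x = (\<integral>z. (MAX j. \<bar>x $ j\<bar> * z $ j) \<partial>\<zeta>)"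
begin

lemma integrable_component [simp, intro]: "integrable \<zeta> (\<lambda>z. z $ j)"
  and integral_component [simp]: "(\<integral>z. z $ j \<partial>\<zeta>) = 1"
  using generator_mean[of j] by (auto simp: has_bochner_integral_iff)

lemma measurable_Max_component [measurable]:
  "(\<lambda>z. MAX j. \<bar>x $ j\<bar> * z $ j) \<in> borel_measurable \<zeta>"
  by measurable

lemma Max_component_nonneg:
  fixes x z :: "real ^ 'd"
  assumes "0 \<le> z" shows "0 \<le> (MAX j. \<bar>x $ j\<bar> * z $ j)"
proof -
  \<comment> \<open>\<open>undefined\<close> is just some index: the index type is nonempty.\<close>
  have "0 \<le> \<bar>x $ undefined\<bar> * z $ undefined" using assms by (simp add: less_eq_vec_def)
  also have "\<dots> \<le> (MAX j. \<bar>x $ j\<bar> * z $ j)" by (intro Max_ge) auto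
  finally show ?thesis .
qed

text \<open>As the components of the generator have mean 1, integrating this bound gives the
  Lipschitz constant 1 of \<open>D\<close>. The case \<open>y = 0\<close> supplies the integrable
  majorant of the maximum.\<close>

lemma Max_component_lipschitz:
  fixes x y z :: "real ^ 'd"
  assumes "0 \<le> z"
  shows "(MAX j. \<bar>x $ j\<bar> * z $ j) \<le> (MAX j. \<bar>y $ j\<bar> * z $ j) + (\<Sum>j\<in>UNIV. \<bar>x $ j - y $ j\<bar> * z $ j)"
proof (rule Max.boundedI; (clarsimp)?)
  fix i :: 'd
  have z: "0 \<le> z $ j" for j using assms by (simp add: less_eq_vec_def)
  have "\<bar>x $ i\<bar> * z $ i \<le> (\<bar>y $ i\<bar> + \<bar>x $ i - y $ i\<bar>) * z $ i"
    using z by (intro mult_right_mono) auto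
  also have "\<dots> = \<bar>y $ i\<bar> * z $ i + \<bar>x $ i - y $ i\<bar> * z $ i" by (simp add: algebra_simps)
  also have "\<bar>y $ i\<bar> * z $ i \<le> (MAX j. \<bar>y $ j\<bar> * z $ j)" by (intro Max_ge) auto
  also have "\<bar>x $ i - y $ i\<bar> * z $ i \<le> (\<Sum>j\<in>UNIV. \<bar>x $ j - y $ j\<bar> * z $ j)"
    using z by (intro member_le_sum) auto
  finally show "\<bar>x $ i\<bar> * z $ i \<le> (MAX j. \<bar>y $ j\<bar> * z $ j) + (\<Sum>j\<in>UNIV. \<bar>x $ j - y $ j\<bar> * z $ j)"
    by simp
qed

lemma integrable_Max_component [simp, intro]:
  "integrable \<zeta> (\<lambda>z. MAX j. \<bar>x $ j\<bar> * z $ j)"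
proof (rule Bochner_Integration.integrable_bound)
  show "integrable \<zeta> (\<lambda>z. \<Sum>j\<in>UNIV. \<bar>x $ j\<bar> * z $ j)"
    by (intro Bochner_Integration.integrable_sum integrable_mult_right) auto
  show "AE z in \<zeta>. norm (MAX j. \<bar>x $ j\<bar> * z $ j) \<le> norm (\<Sum>j\<in>UNIV. \<bar>x $ j\<bar> * z $ j)"
    using generator_nonneg
  proof eventually_elim
    case (elim z)
    then show ?case
      using Max_component_nonneg[of z x] Max_component_lipschitz[of z x 0]
      by (simp del: Max_le_iff)
  qed
qed measurable

lemma D_zero [simp]: "D 0 = 0"
  by (simp add: D_eq)

lemma D_diff_le: "D x - D y \<le> (\<Sum>j\<in>UNIV. \<bar>x $ j - y $ j\<bar>)"
proof -
  have "D x \<le> (\<integral>z. (MAX j. \<bar>y $ j\<bar> * z $ j) + (\<Sum>j\<in>UNIV. \<bar>x $ j - y $ j\<bar> * z $ j) \<partial>\<zeta>)"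
    unfolding D_eq using generator_nonneg
    by (intro integral_mono_AE Bochner_Integration.integrable_add Bochner_Integration.integrable_sum
        integrable_mult_right integrable_Max_component)
       (auto elim!: eventually_mono intro: Max_component_lipschitz simp del: Max_le_iff)
  also have "\<dots> = D y + (\<Sum>j\<in>UNIV. \<bar>x $ j - y $ j\<bar>)"
    unfolding D_eq
    by (subst Bochner_Integration.integral_add)
       (auto intro!: Bochner_Integration.integrable_sum simp: Bochner_Integration.integral_sum)
  finally show ?thesis by simp
qed

lemma D_lipschitz: "\<bar>D x - D y\<bar> \<le> (\<Sum>j\<in>UNIV. \<bar>x $ j - y $ j\<bar>)"
  using D_diff_le[of x y] D_diff_le[of y x] by (simp add: abs_le_iff abs_minus_commute)

text \<open>The maximum dominates its \<open>j\<close>-th term, whose expectation is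
  \<open>\<bar>x $ j\<bar>\<close> by the mean-one condition.\<close>

lemma component_le_D: "\<bar>x $ j\<bar> \<le> D x"
proof -
  have "(\<integral>z. \<bar>x $ j\<bar> * z $ j \<partial>\<zeta>) \<le> D x"
    unfolding D_eq by (intro integral_mono) (auto intro: Max_ge)
  then show ?thesis by simp
qed

lemma D_nonneg: "0 \<le> D x"
  using component_le_D[of x] by (metis abs_ge_zero order_trans)

lemma ennreal_D_eq: "ennreal (D x) = (\<integral>\<^sup>+z. ennreal (MAX j. \<bar>x $ j\<bar> * z $ j) \<partial>\<zeta>)"
  unfolding D_eq
  by (rule nn_integral_eq_integral[symmetric])
     (use generator_nonneg in \<open>auto elim!: eventually_mono intro: Max_component_nonneg\<close>)

lemma D_measurable [measurable]: "D \<in> borel_measurable borel"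
  using D_lipschitz by (intro borel_measurable_of_lipschitz[where L=1]) simp

lemma measurable_layer [measurable]:
  fixes V :: "'a \<Rightarrow> real ^ 'd"
  assumes "prob_space Q" and [measurable]: "V \<in> borel_measurable Q"
  shows "(\<lambda>p. measure Q {\<omega> \<in> space Q. snd p \<le> (MAX j. \<bar>V \<omega> $ j\<bar> * fst p $ j)} * indicator {0<..} (snd p))
    \<in> borel_measurable (\<zeta> \<Otimes>\<^sub>M (lborel :: real measure))"
proof -
  interpret Q: prob_space Q by fact
  show ?thesis by measurable
qed

text \<open>Tonelli moves the generator outside, and the layer cake formula is applied for each
  fixed \<open>z\<close>. Afterwards \<open>V\<close> enters only through probabilities, integrated
  against a measure that does not depend on \<open>V\<close>; this makes dominated convergence
  applicable to a sequence of vectors \<open>V\<close>.\<close>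

lemma expectation_D_eq:
  fixes V :: "'a \<Rightarrow> real ^ 'd"
  assumes "prob_space Q" and [measurable]: "V \<in> borel_measurable Q"
  shows "(\<integral>\<omega>. D (V \<omega>) \<partial>Q) =
    (\<integral>p. measure Q {\<omega> \<in> space Q. snd p \<le> (MAX j. \<bar>V \<omega> $ j\<bar> * fst p $ j)} * indicator {0<..} (snd p)
      \<partial>(\<zeta> \<Otimes>\<^sub>M lborel))" (is "_ = (\<integral>p. ?p p \<partial>_)")
proof -
  interpret Q: prob_space Q by fact
  interpret Q\<zeta>: pair_sigma_finite Q \<zeta> ..
  have [measurable]: "?p \<in> borel_measurable (\<zeta> \<Otimes>\<^sub>M (lborel :: real measure))"
    by (rule measurable_layer) fact+
  have "(\<integral>\<^sup>+\<omega>. ennreal (D (V \<omega>)) \<partial>Q) = (\<integral>\<^sup>+\<omega>. \<integral>\<^sup>+z. ennreal (MAX j. \<bar>V \<omega> $ j\<bar> * z $ j) \<partial>\<zeta> \<partial>Q)"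
    by (simp only: ennreal_D_eq)
  also have "\<dots> = (\<integral>\<^sup>+z. \<integral>\<^sup>+\<omega>. ennreal (MAX j. \<bar>V \<omega> $ j\<bar> * z $ j) \<partial>Q \<partial>\<zeta>)"
    by (intro Q\<zeta>.Fubini'[symmetric]) measurable
  also have "\<dots> = (\<integral>\<^sup>+z. \<integral>\<^sup>+t. ennreal (?p (z, t)) \<partial>lborel \<partial>\<zeta>)"
  proof (rule nn_integral_cong)
    fix z assume "z \<in> space \<zeta>"
    show "(\<integral>\<^sup>+\<omega>. ennreal (MAX j. \<bar>V \<omega> $ j\<bar> * z $ j) \<partial>Q) = (\<integral>\<^sup>+t. ennreal (?p (z, t)) \<partial>lborel)"
      by (subst nn_integral_layer_cake)
         (auto intro!: nn_integral_cong Q.sigma_finite_measure_axioms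
           simp: Q.emeasure_eq_measure ennreal_mult ennreal_indicator simp del: Max_ge_iff split: split_indicator)
  qed
  also have "\<dots> = (\<integral>\<^sup>+p. ennreal (?p p) \<partial>(\<zeta> \<Otimes>\<^sub>M lborel))"
    by (subst lborel.nn_integral_fst[symmetric]) auto
  \<comment> \<open>Both Bochner integrals are \<open>enn2real\<close> of the same nonnegative
    integral, so the identity also holds, as \<open>0 = 0\<close>, when that integral is
    infinite.\<close>
  finally have "enn2real (\<integral>\<^sup>+\<omega>. ennreal (D (V \<omega>)) \<partial>Q) = enn2real (\<integral>\<^sup>+p. ennreal (?p p) \<partial>(\<zeta> \<Otimes>\<^sub>M lborel))"
    by simp
  then show ?thesis
    by (subst (1 2) integral_eq_nn_integral) (auto simp: D_nonneg)
qed

text \<open>The majorant for dominated convergence: the exponentials absorb the tails of the random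
  vector, the indicator absorbs the fixed vector \<open>x\<close>. Integrating over \<open>t\<close>
  leaves the sum of \<open>(2 + \<bar>x $ j\<bar>) * z $ j\<close>, which has finite mean under the
  generator.\<close>

lemma integrable_layer_bound:
  fixes x :: "real ^ 'd"
  shows "integrable (\<zeta> \<Otimes>\<^sub>M lborel)
    (\<lambda>p. ((\<Sum>j\<in>UNIV. if 0 < fst p $ j then exp (- (snd p / (2 * fst p $ j))) else 0) +
      indicator {0<..\<Sum>j\<in>UNIV. \<bar>x $ j\<bar> * fst p $ j} (snd p)) * indicator {0<..} (snd p))"
    (is "integrable _ ?w")
proof (rule integrableI_nonneg)
  \<comment> \<open>An indicator of an interval whose endpoint varies with \<open>p\<close> is
    rewritten as a conditional, in which measurability is visible.\<close>
  have "?w = (\<lambda>p. ((\<Sum>j\<in>UNIV. if 0 < fst p $ j then exp (- (snd p / (2 * fst p $ j))) else 0) +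
      (if 0 < snd p \<and> snd p \<le> (\<Sum>j\<in>UNIV. \<bar>x $ j\<bar> * fst p $ j) then 1 else 0)) * indicator {0<..} (snd p))"
    by (auto simp: fun_eq_iff split: split_indicator)
  also have "\<dots> \<in> borel_measurable (\<zeta> \<Otimes>\<^sub>M lborel)" by measurable
  finally show meas [measurable]: "?w \<in> borel_measurable (\<zeta> \<Otimes>\<^sub>M lborel)" .
  show "AE p in \<zeta> \<Otimes>\<^sub>M lborel. 0 \<le> ?w p"
    by (intro AE_I2 mult_nonneg_nonneg add_nonneg_nonneg sum_nonneg) auto
  have "(\<integral>\<^sup>+p. ennreal (?w p) \<partial>(\<zeta> \<Otimes>\<^sub>M lborel)) = (\<integral>\<^sup>+z. \<integral>\<^sup>+t. ennreal (?w (z, t)) \<partial>lborel \<partial>\<zeta>)"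
    by (intro lborel.nn_integral_fst[symmetric]) measurable
  also have "\<dots> = (\<integral>\<^sup>+z. ennreal (\<Sum>j\<in>UNIV. (2 + \<bar>x $ j\<bar>) * z $ j) \<partial>\<zeta>)"
  proof (rule nn_integral_cong_AE)
    show "AE z in \<zeta>. (\<integral>\<^sup>+t. ennreal (?w (z, t)) \<partial>lborel) = ennreal (\<Sum>j\<in>UNIV. (2 + \<bar>x $ j\<bar>) * z $ j)"
      using generator_nonneg
    proof eventually_elim
      case (elim z)
      then have z: "0 \<le> z $ j" for j by (simp add: less_eq_vec_def)
      define s where "s = (\<Sum>j\<in>UNIV. \<bar>x $ j\<bar> * z $ j)"
      have "0 \<le> s" unfolding s_def using z by (intro sum_nonneg) auto
      define g where "g j t = ennreal (if 0 < z $ j then exp (- (t / (2 * z $ j))) else 0) * indicator {0<..} t" for j t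
      have [measurable]: "g j \<in> borel_measurable borel" for j unfolding g_def by measurable
      have "(\<integral>\<^sup>+t. ennreal (?w (z, t)) \<partial>lborel) = (\<integral>\<^sup>+t. (\<Sum>j\<in>UNIV. g j t) + indicator {0<..s} t \<partial>lborel)"
        by (intro nn_integral_cong, unfold fst_conv snd_conv)
           (auto simp: g_def s_def[symmetric] sum_ennreal sum_nonneg split: split_indicator)
      also have "\<dots> = (\<Sum>j\<in>UNIV. \<integral>\<^sup>+t. g j t \<partial>lborel) + ennreal s"
        using \<open>0 \<le> s\<close> by (subst nn_integral_add) (auto simp: nn_integral_sum)
      also have "(\<Sum>j\<in>UNIV. \<integral>\<^sup>+t. g j t \<partial>lborel) = (\<Sum>j\<in>UNIV. ennreal (2 * z $ j))"
      proof (rule sum.cong[OF refl])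
        fix j
        show "(\<integral>\<^sup>+t. g j t \<partial>lborel) = ennreal (2 * z $ j)"
          using nn_integral_exp_tail[of "2 * z $ j" 0] z[of j]
          by (cases "z $ j = 0") (auto simp: g_def)
      qed
      finally show ?case
        using z \<open>0 \<le> s\<close>
        by (simp add: sum_ennreal ennreal_plus[symmetric] sum_nonneg s_def sum.distrib algebra_simps
            del: ennreal_plus)
    qed
  qed
  also have "\<dots> < \<infinity>"
  proof -
    have "integrable \<zeta> (\<lambda>z. \<Sum>j\<in>UNIV. (2 + \<bar>x $ j\<bar>) * z $ j)"
      by (intro Bochner_Integration.integrable_sum integrable_mult_right) auto
    moreover have "AE z in \<zeta>. 0 \<le> (\<Sum>j\<in>UNIV. (2 + \<bar>x $ j\<bar>) * z $ j)"
      using generator_nonneg by eventually_elim (auto intro!: sum_nonneg simp: less_eq_vec_def)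
    ultimately show ?thesis by (simp add: nn_integral_eq_integral)
  qed
  finally show "(\<integral>\<^sup>+p. ennreal (?w p) \<partial>(\<zeta> \<Otimes>\<^sub>M lborel)) < \<infinity>" .
qed

end

section \<open>Convergence of expectations\<close>

text \<open>Pointwise convergence on a finite net spreads to the whole compact set. The factor
  \<open>L\<close> bounds the sum norm by the metric, so a net of radius \<open>e / (3 * L)\<close>
  costs less than \<open>e / 3\<close> for \<open>f n\<close>, for \<open>g\<close>, and for their
  difference at the net point.\<close>

lemma uniform_of_equilipschitz:
  fixes f :: "nat \<Rightarrow> real ^ 'd \<Rightarrow> real"
  assumes f: "\<And>n x y. \<bar>f n x - f n y\<bar> \<le> (\<Sum>j\<in>UNIV. \<bar>x $ j - y $ j\<bar>)"
    and g: "\<And>x y. \<bar>g x - g y\<bar> \<le> (\<Sum>j\<in>UNIV. \<bar>x $ j - y $ j\<bar>)"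
    and lim: "\<And>x. x \<in> S \<Longrightarrow> (\<lambda>n. f n x) \<longlonglongrightarrow> g x"
    and "compact S" "0 < e"
  shows "eventually (\<lambda>n. \<forall>x\<in>S. \<bar>f n x - g x\<bar> < e) sequentially"
proof -
  define L where "L = real CARD('d)"
  have "0 < L" by (simp add: L_def)
  have sum_le: "(\<Sum>j\<in>UNIV. \<bar>x $ j - y $ j\<bar>) \<le> L * dist x y" for x y :: "real ^ 'd"
  proof -
    have "(\<Sum>j\<in>UNIV. \<bar>x $ j - y $ j\<bar>) \<le> (\<Sum>j\<in>(UNIV :: 'd set). dist x y)"
      using component_le_norm_cart[of "x - y"] by (intro sum_mono) (simp add: dist_norm)
    then show ?thesis by (simp add: L_def)
  qed
  obtain A where "finite A" "A \<subseteq> S" and cover: "S \<subseteq> (\<Union>a\<in>A. ball a (e / (3 * L)))"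
    using \<open>0 < e\<close> \<open>0 < L\<close> by (rule_tac compactE_image[OF \<open>compact S\<close>, of S "\<lambda>a. ball a (e / (3 * L))"]) auto
  have "eventually (\<lambda>n. \<forall>a\<in>A. \<bar>f n a - g a\<bar> < e / 3) sequentially"
  proof (rule eventually_ball_finite[OF \<open>finite A\<close>], rule ballI)
    fix a assume "a \<in> A"
    then have "(\<lambda>n. f n a) \<longlonglongrightarrow> g a" using lim \<open>A \<subseteq> S\<close> by auto
    then show "eventually (\<lambda>n. \<bar>f n a - g a\<bar> < e / 3) sequentially"
      using tendstoD[of _ _ _ "e / 3"] \<open>0 < e\<close> by (fastforce simp: dist_real_def)
  qed
  then show ?thesis
  proof eventually_elim
    case (elim n)
    show ?case
    proof
      fix x assume "x \<in> S"
      then obtain a where "a \<in> A" "dist a x < e / (3 * L)" using cover by auto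
      then have "L * dist x a < e / 3"
        using \<open>0 < L\<close> by (simp add: field_simps dist_commute)
      moreover have "\<bar>f n a - g a\<bar> < e / 3" using elim \<open>a \<in> A\<close> by auto
      ultimately show "\<bar>f n x - g x\<bar> < e"
        using f[of n x a] g[of x a] sum_le[of x a] by linarith
    qed
  qed
qed

text \<open>Here \<open>Y n\<close> stands for the rescaled maximum of \<open>n + 1\<close>
  observations with scale \<open>n + 2\<close>. The rate 1/2 in \<open>tail\<close> is the uniform
  lower bound of \<open>(n + 1) / (n + 2)\<close>.\<close>

locale nonpos_df_limit = M: prob_space M + N: prob_space N
  for M :: "'a measure" and N :: "'b measure" +
  fixes Y :: "nat \<Rightarrow> 'a \<Rightarrow> real ^ 'd" and \<eta> :: "'b \<Rightarrow> real ^ 'd"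
  assumes Y_measurable [measurable]: "Y n \<in> borel_measurable M"
    and \<eta>_measurable [measurable]: "\<eta> \<in> borel_measurable N"
    and Y_nonpos: "AE \<omega> in M. Y n \<omega> \<le> 0"
    and \<eta>_nonpos: "AE \<omega> in N. \<eta> \<omega> \<le> 0"
    and df_tendsto: "y \<le> 0 \<Longrightarrow> (\<lambda>n. \<P>(\<omega> in M. Y n \<omega> \<le> y)) \<longlonglongrightarrow> \<P>(\<omega> in N. \<eta> \<omega> \<le> y)"
    and tail: "0 \<le> t \<Longrightarrow> \<P>(\<omega> in M. Y n \<omega> $ j \<le> - t) \<le> exp (- (t / 2))"
begin

text \<open>Inclusion-exclusion as an induction on \<open>S\<close>: the event with
  \<open>a i < Y n \<omega> $ i\<close> is the event without a condition on \<open>i\<close> minus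
  the one with the reverse inequality, so \<open>i\<close> moves into \<open>T\<close>. Hence
  \<open>T\<close> must be arbitrary, although the application has \<open>T\<close> empty.\<close>

lemma orthant_prob_tendsto:
  assumes "finite S" "\<And>j. a j \<le> 0"
  shows "(\<lambda>n. \<P>(\<omega> in M. (\<forall>j\<in>T. Y n \<omega> $ j \<le> a j) \<and> (\<forall>j\<in>S. a j < Y n \<omega> $ j)))
    \<longlonglongrightarrow> \<P>(\<omega> in N. (\<forall>j\<in>T. \<eta> \<omega> $ j \<le> a j) \<and> (\<forall>j\<in>S. a j < \<eta> \<omega> $ j))"
  using \<open>finite S\<close>
proof (induction S arbitrary: T)
  case empty
  \<comment> \<open>The bound 0 imposes no condition on the other components, since the vectors are
    almost surely nonpositive.\<close>
  define y :: "real ^ 'd" where "y = (\<chi> j. if j \<in> T then a j else 0)"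
  have y: "y \<le> 0" using assms(2) by (simp add: y_def less_eq_vec_def)
  have *: "v \<le> y \<longleftrightarrow> (\<forall>j\<in>T. v $ j \<le> a j)" if "v \<le> 0" for v
    using that by (auto simp: y_def less_eq_vec_def)
  have "\<P>(\<omega> in M. Y n \<omega> \<le> y) = \<P>(\<omega> in M. (\<forall>j\<in>T. Y n \<omega> $ j \<le> a j))" for n
    using Y_nonpos[of n] by (intro M.prob_eq_AE) (auto simp: *)
  moreover have "\<P>(\<omega> in N. \<eta> \<omega> \<le> y) = \<P>(\<omega> in N. (\<forall>j\<in>T. \<eta> \<omega> $ j \<le> a j))"
    using \<eta>_nonpos by (intro N.prob_eq_AE) (auto simp: *)
  ultimately show ?case using df_tendsto[OF y] by simp
next
  case (insert i S)
  have split: "\<P>(\<omega> in Q. (\<forall>j\<in>T. V \<omega> $ j \<le> a j) \<and> (\<forall>j\<in>insert i S. a j < V \<omega> $ j)) =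
      \<P>(\<omega> in Q. (\<forall>j\<in>T. V \<omega> $ j \<le> a j) \<and> (\<forall>j\<in>S. a j < V \<omega> $ j)) -
      \<P>(\<omega> in Q. (\<forall>j\<in>insert i T. V \<omega> $ j \<le> a j) \<and> (\<forall>j\<in>S. a j < V \<omega> $ j))"
    if "prob_space Q" and [measurable]: "V \<in> borel_measurable Q"
    for V :: "'x \<Rightarrow> real ^ 'd" and Q :: "'x measure"
  proof -
    interpret Q: prob_space Q by fact
    show ?thesis
      by (subst Q.finite_measure_Diff[symmetric]) (auto intro!: arg_cong[where f="measure Q"])
  qed
  show ?case
    unfolding split[OF M.prob_space_axioms Y_measurable] split[OF N.prob_space_axioms \<eta>_measurable]
    by (intro tendsto_diff insert.IH)
qed

lemma integrable_Y [simp, intro]: "integrable M (\<lambda>\<omega>. Y n \<omega> $ j)"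
proof -
  have "integrable M (\<lambda>\<omega>. - Y n \<omega> $ j)"
  proof (rule integrableI_nonneg)
    show "AE \<omega> in M. 0 \<le> - Y n \<omega> $ j"
      using Y_nonpos[of n] by eventually_elim (simp add: less_eq_vec_def)
    show "(\<integral>\<^sup>+\<omega>. ennreal (- Y n \<omega> $ j) \<partial>M) < \<infinity>"
      using nn_integral_excess_le[OF M.prob_space_axioms, of "\<lambda>\<omega>. Y n \<omega> $ j" 2 0] tail
      by (auto intro: le_less_trans)
  qed measurable
  then show ?thesis by simp
qed

lemma integrable_lipschitz_inf:
  fixes x :: "real ^ 'd"
  assumes f: "\<And>x y. \<bar>f x - f y\<bar> \<le> (\<Sum>j\<in>UNIV. \<bar>x $ j - y $ j\<bar>)"
  shows "integrable M (\<lambda>\<omega>. f (inf x (Y n \<omega>)))"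
proof (rule Bochner_Integration.integrable_bound)
  have [measurable]: "f \<in> borel_measurable borel"
    using f by (intro borel_measurable_of_lipschitz[where L=1]) simp
  show "(\<lambda>\<omega>. f (inf x (Y n \<omega>))) \<in> borel_measurable M" by measurable
  show "integrable M (\<lambda>\<omega>. \<bar>f 0\<bar> + (\<Sum>j\<in>UNIV. \<bar>x $ j\<bar> + \<bar>Y n \<omega> $ j\<bar>))"
    by (intro Bochner_Integration.integrable_add Bochner_Integration.integrable_sum) auto
  show "AE \<omega> in M. norm (f (inf x (Y n \<omega>))) \<le> norm (\<bar>f 0\<bar> + (\<Sum>j\<in>UNIV. \<bar>x $ j\<bar> + \<bar>Y n \<omega> $ j\<bar>))"
  proof (rule AE_I2)
    fix \<omega>
    have "(\<Sum>j\<in>UNIV. \<bar>inf x (Y n \<omega>) $ j - 0 $ j\<bar>) \<le> (\<Sum>j\<in>UNIV. \<bar>x $ j\<bar> + \<bar>Y n \<omega> $ j\<bar>)"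
      by (intro sum_mono) (auto simp: inf_vec_def inf_real_def)
    then show "norm (f (inf x (Y n \<omega>))) \<le> norm (\<bar>f 0\<bar> + (\<Sum>j\<in>UNIV. \<bar>x $ j\<bar> + \<bar>Y n \<omega> $ j\<bar>))"
      using f[of "inf x (Y n \<omega>)" 0] by simp
  qed
qed

text \<open>On the box from \<open>- R\<close> to 0 the convergence is uniform. Outside it, both
  functions are compared with their values at the point clipped to the box; the Lipschitz bounds
  reduce the error to expected excesses over \<open>R\<close>, which are small uniformly in
  \<open>n\<close>.\<close>

lemma expectation_diff_tendsto_0:
  fixes x :: "real ^ 'd" and f :: "nat \<Rightarrow> real ^ 'd \<Rightarrow> real"
  assumes f: "\<And>n x y. \<bar>f n x - f n y\<bar> \<le> (\<Sum>j\<in>UNIV. \<bar>x $ j - y $ j\<bar>)"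
    and g: "\<And>x y. \<bar>g x - g y\<bar> \<le> (\<Sum>j\<in>UNIV. \<bar>x $ j - y $ j\<bar>)"
    and lim: "\<And>x. x \<le> 0 \<Longrightarrow> (\<lambda>n. f n x) \<longlonglongrightarrow> g x"
    and "x \<le> 0"
  shows "(\<lambda>n. \<integral>\<omega>. f n (inf x (Y n \<omega>)) - g (inf x (Y n \<omega>)) \<partial>M) \<longlonglongrightarrow> 0"
proof (rule tendstoI)
  fix e :: real assume "0 < e"
  define d where "d = real CARD('d)"
  \<comment> \<open>The 4 is 2 for the two Lipschitz estimates, of \<open>f n\<close> and of
    \<open>g\<close>, times 2 from the tail bound \<open>2 * exp (- (R / 2))\<close> of each of the
    \<open>d\<close> excesses.\<close>
  have "((\<lambda>R. 4 * d * exp (- (R / 2))) \<longlongrightarrow> 0) at_top" by real_asymp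
  then have "eventually (\<lambda>R. 4 * d * exp (- (R / 2)) < e / 2) at_top"
    using \<open>0 < e\<close> by (intro order_tendstoD) auto
  moreover have "eventually (\<lambda>R. (\<Sum>j\<in>UNIV. \<bar>x $ j\<bar>) \<le> R) at_top"
    by (rule eventually_ge_at_top)
  ultimately have "eventually (\<lambda>R. 4 * d * exp (- (R / 2)) < e / 2 \<and> (\<Sum>j\<in>UNIV. \<bar>x $ j\<bar>) \<le> R) at_top"
    by eventually_elim simp
  then obtain R where R: "4 * d * exp (- (R / 2)) < e / 2" "(\<Sum>j\<in>UNIV. \<bar>x $ j\<bar>) \<le> R"
    by (auto simp: eventually_at_top_linorder)
  have xR: "\<bar>x $ j\<bar> \<le> R" for j
    using R(2) member_le_sum[of j UNIV "\<lambda>j. \<bar>x $ j\<bar>"] by auto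
  have "0 \<le> R" using xR[of undefined] by linarith
  define B :: "(real ^ 'd) set" where "B = cbox (- R *\<^sub>R 1) 0"
  have "eventually (\<lambda>n. \<forall>v\<in>B. \<bar>f n v - g v\<bar> < e / 2) sequentially"
    using f g
  proof (rule uniform_of_equilipschitz)
    show "(\<lambda>n. f n v) \<longlonglongrightarrow> g v" if "v \<in> B" for v
      using that by (intro lim) (auto simp: B_def mem_box_cart less_eq_vec_def)
  qed (use \<open>0 < e\<close> in \<open>auto simp: B_def\<close>)
  then show "eventually (\<lambda>n. dist (\<integral>\<omega>. f n (inf x (Y n \<omega>)) - g (inf x (Y n \<omega>)) \<partial>M) 0 < e) sequentially"
  proof eventually_elim
    case (elim n)
    define W where "W \<omega> = inf x (Y n \<omega>)" for \<omega>
    define E where "E \<omega> = (\<Sum>j\<in>UNIV. max 0 (- Y n \<omega> $ j - R))" for \<omega>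
    have E_int: "integrable M (\<lambda>\<omega>. max 0 (- Y n \<omega> $ j - R))" for j
      by (intro integrable_max) auto
    have E_le: "(\<integral>\<omega>. max 0 (- Y n \<omega> $ j - R) \<partial>M) \<le> 2 * exp (- (R / 2))" for j
    proof -
      have "ennreal (\<integral>\<omega>. max 0 (- Y n \<omega> $ j - R) \<partial>M) = (\<integral>\<^sup>+\<omega>. ennreal (- Y n \<omega> $ j - R) \<partial>M)"
        by (subst nn_integral_eq_integral[symmetric, OF E_int])
           (auto intro!: nn_integral_cong simp: max_def ennreal_neg)
      also have "\<dots> \<le> ennreal (2 * exp (- (R / 2)))"
        using tail \<open>0 \<le> R\<close> by (intro nn_integral_excess_le) (auto intro: M.prob_space_axioms)
      finally show ?thesis by (simp add: ennreal_le_iff)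
    qed
    have f_int: "integrable M (\<lambda>\<omega>. f n (W \<omega>))" and g_int: "integrable M (\<lambda>\<omega>. g (W \<omega>))"
      unfolding W_def by (rule integrable_lipschitz_inf[OF f], rule integrable_lipschitz_inf[OF g])
    have "\<bar>\<integral>\<omega>. f n (W \<omega>) - g (W \<omega>) \<partial>M\<bar> \<le> (\<integral>\<omega>. \<bar>f n (W \<omega>) - g (W \<omega>)\<bar> \<partial>M)"
      by (rule integral_abs_bound)
    also have "\<dots> \<le> (\<integral>\<omega>. e / 2 + 2 * E \<omega> \<partial>M)"
    proof (rule integral_mono)
      show "integrable M (\<lambda>\<omega>. \<bar>f n (W \<omega>) - g (W \<omega>)\<bar>)" using f_int g_int by auto
      show "integrable M (\<lambda>\<omega>. e / 2 + 2 * E \<omega>)"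
        unfolding E_def using E_int by auto
      fix \<omega>
      \<comment> \<open>Clipping at \<open>- R\<close> lands in \<open>B\<close>. As
        \<open>\<bar>x $ j\<bar> \<le> R\<close>, a component of \<open>W \<omega>\<close> can lie
        below \<open>- R\<close> only because of \<open>Y n \<omega>\<close>, so it moves by at most
        the excess of \<open>Y n\<close>.\<close>
      define v where "v = (\<chi> j. max (W \<omega> $ j) (- R))"
      have "v \<in> B"
        using \<open>x \<le> 0\<close> \<open>0 \<le> R\<close>
        by (auto simp: B_def mem_box_cart v_def W_def inf_vec_def less_eq_vec_def inf_real_def le_max_iff_disj
            intro: min.coboundedI1)
      then have 1: "\<bar>f n v - g v\<bar> < e / 2" using elim by auto
      have 2: "(\<Sum>j\<in>UNIV. \<bar>W \<omega> $ j - v $ j\<bar>) \<le> E \<omega>"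
        unfolding E_def
      proof (rule sum_mono)
        fix j
        show "\<bar>W \<omega> $ j - v $ j\<bar> \<le> max 0 (- Y n \<omega> $ j - R)"
          using xR[of j] by (auto simp: v_def W_def inf_vec_def inf_real_def max_def min_def)
      qed
      show "\<bar>f n (W \<omega>) - g (W \<omega>)\<bar> \<le> e / 2 + 2 * E \<omega>"
        using 1 2 f[of n "W \<omega>" v] g[of "W \<omega>" v] by linarith
    qed
    also have "\<dots> = e / 2 + 2 * (\<Sum>j\<in>UNIV. \<integral>\<omega>. max 0 (- Y n \<omega> $ j - R) \<partial>M)"
      unfolding E_def using E_int
      by (subst Bochner_Integration.integral_add) (auto simp: M.prob_space)
    also have "\<dots> \<le> e / 2 + 2 * (\<Sum>j\<in>(UNIV :: 'd set). 2 * exp (- (R / 2)))"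
      by (intro add_mono mult_left_mono sum_mono E_le) auto
    also have "\<dots> < e"
      using R(1) by (simp add: d_def)
    finally show ?case by (simp add: W_def)
  qed
qed

end

section \<open>Passing to the limit in expectations of a D-norm\<close>

locale D_norm_nonpos_limit = nonpos_df_limit M N Y \<eta> + D_norm_generator \<zeta> D
  for M :: "'a measure" and N :: "'b measure" and Y :: "nat \<Rightarrow> 'a \<Rightarrow> real ^ 'd"
    and \<eta> :: "'b \<Rightarrow> real ^ 'd" and \<zeta> :: "(real ^ 'd) measure" and D :: "real ^ 'd \<Rightarrow> real"
begin

text \<open>By \<open>expectation_D_eq\<close> all expectations become integrals over pairs
  \<open>(z, t)\<close>. The integrands converge by \<open>prob_Max_inf_ge\<close> and
  \<open>orthant_prob_tendsto\<close>, and they are dominated by the function of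
  \<open>integrable_layer_bound\<close>.\<close>

lemma expectation_D_inf_tendsto:
  assumes "x \<le> 0"
  shows "(\<lambda>n. \<integral>\<omega>. D (inf x (Y n \<omega>)) \<partial>M) \<longlonglongrightarrow> (\<integral>\<omega>. D (inf x (\<eta> \<omega>)) \<partial>N)"
proof -
  have AE_pair: "AE p in \<zeta> \<Otimes>\<^sub>M (lborel :: real measure). 0 \<le> fst p"
  proof -
    interpret pair_sigma_finite \<zeta> "lborel :: real measure" ..
    show ?thesis
    proof (subst AE_pair_iff[symmetric, where P="\<lambda>z t. 0 \<le> z"])
      show "{p \<in> space (\<zeta> \<Otimes>\<^sub>M (lborel :: real measure)). 0 \<le> fst p} \<in> sets (\<zeta> \<Otimes>\<^sub>M lborel)"
        by measurable
    qed (use generator_nonneg in auto)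
  qed
  have [measurable]: "(\<lambda>\<omega>. inf x (Y n \<omega>)) \<in> borel_measurable M" for n by measurable
  have [measurable]: "(\<lambda>\<omega>. inf x (\<eta> \<omega>)) \<in> borel_measurable N" by measurable
  show ?thesis
    unfolding expectation_D_eq[OF M.prob_space_axioms \<open>(\<lambda>\<omega>. inf x (Y _ \<omega>)) \<in> borel_measurable M\<close>]
      expectation_D_eq[OF N.prob_space_axioms \<open>(\<lambda>\<omega>. inf x (\<eta> \<omega>)) \<in> borel_measurable N\<close>]
  proof (rule integral_dominated_convergence[OF _ _ integrable_layer_bound[of x]])
    show "AE p in \<zeta> \<Otimes>\<^sub>M lborel. (\<lambda>n. \<P>(\<omega> in M. snd p \<le> (MAX j. \<bar>inf x (Y n \<omega>) $ j\<bar> * fst p $ j)) *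
        indicator {0<..} (snd p)) \<longlonglongrightarrow>
        \<P>(\<omega> in N. snd p \<le> (MAX j. \<bar>inf x (\<eta> \<omega>) $ j\<bar> * fst p $ j)) * indicator {0<..} (snd p)"
      using AE_pair
    proof eventually_elim
      case (elim p)
      obtain z t where p: "p = (z, t)" by (cases p)
      show ?case
      proof (cases "0 < t")
        case True
        \<comment> \<open>The value 0 where \<open>z $ j = 0\<close> only keeps all thresholds
          nonpositive; these components are not in the orthant condition.\<close>
        define a where "a j = (if 0 < z $ j then - (t / z $ j) else 0)" for j
        have a: "a j \<le> 0" for j using True by (simp add: a_def)
        have "(\<lambda>n. \<P>(\<omega> in M. \<forall>j\<in>{j. 0 < z $ j}. - (t / z $ j) < Y n \<omega> $ j)) \<longlonglongrightarrow>
          \<P>(\<omega> in N. \<forall>j\<in>{j. 0 < z $ j}. - (t / z $ j) < \<eta> \<omega> $ j)"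
          using orthant_prob_tendsto[of "{j. 0 < z $ j}" a "{}"] a by (simp add: a_def)
        then show ?thesis
          using True elim
          by (simp add: p M.prob_Max_inf_ge[OF Y_measurable Y_nonpos \<open>x \<le> 0\<close>]
              N.prob_Max_inf_ge[OF \<eta>_measurable \<eta>_nonpos \<open>x \<le> 0\<close>] tendsto_diff del: Max_ge_iff)
      qed (simp add: p)
    qed
    fix n
    show "AE p in \<zeta> \<Otimes>\<^sub>M lborel. norm (\<P>(\<omega> in M. snd p \<le> (MAX j. \<bar>inf x (Y n \<omega>) $ j\<bar> * fst p $ j)) *
        indicator {0<..} (snd p)) \<le>
        ((\<Sum>j\<in>UNIV. if 0 < fst p $ j then exp (- (snd p / (2 * fst p $ j))) else 0) +
      indicator {0<..\<Sum>j\<in>UNIV. \<bar>x $ j\<bar> * fst p $ j} (snd p)) * indicator {0<..} (snd p)"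
      using AE_pair
    proof eventually_elim
      case (elim p)
      obtain z t where p: "p = (z, t)" by (cases p)
      have z: "0 \<le> z $ j" for j using elim by (simp add: p less_eq_vec_def)
      define S where "S = {j. 0 < z $ j}"
      have sum_eq: "(\<Sum>j\<in>UNIV. if 0 < z $ j then exp (- (t / (2 * z $ j))) else 0) =
          (\<Sum>j\<in>S. exp (- (t / (2 * z $ j))))"
        by (simp add: S_def sum.If_cases)
      \<comment> \<open>If a term of \<open>x\<close> alone reaches \<open>t\<close>, the indicator
        equals 1 and covers any probability. Otherwise the orthant formula and the union bound over
        \<open>S\<close> leave only tails of single components.\<close>
      have "\<P>(\<omega> in M. t \<le> (MAX j. \<bar>inf x (Y n \<omega>) $ j\<bar> * z $ j)) \<le>
          (\<Sum>j\<in>S. exp (- (t / (2 * z $ j)))) + indicator {0<..\<Sum>j\<in>UNIV. \<bar>x $ j\<bar> * z $ j} t"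
        if "0 < t"
      proof (cases "\<exists>j. t \<le> \<bar>x $ j\<bar> * z $ j")
        case True
        then obtain j where "t \<le> \<bar>x $ j\<bar> * z $ j" ..
        also have "\<dots> \<le> (\<Sum>j\<in>UNIV. \<bar>x $ j\<bar> * z $ j)" using z by (intro member_le_sum) auto
        finally have "indicator {0<..\<Sum>j\<in>UNIV. \<bar>x $ j\<bar> * z $ j} t = (1 :: real)" using that by simp
        moreover have "0 \<le> (\<Sum>j\<in>S. exp (- (t / (2 * z $ j))))" by (intro sum_nonneg) simp
        ultimately show ?thesis
          using M.prob_le_1[of "{\<omega> \<in> space M. t \<le> (MAX j. \<bar>inf x (Y n \<omega>) $ j\<bar> * z $ j)}"] by linarith
      next
        case False
        then have "\<P>(\<omega> in M. t \<le> (MAX j. \<bar>inf x (Y n \<omega>) $ j\<bar> * z $ j)) =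
            1 - \<P>(\<omega> in M. \<forall>j\<in>S. - (t / z $ j) < Y n \<omega> $ j)"
          using M.prob_Max_inf_ge[OF Y_measurable[of n] Y_nonpos \<open>x \<le> 0\<close>, of z t] elim that
          by (simp add: p S_def del: Max_ge_iff)
        \<comment> \<open>The union bound applied to the sure event: either the orthant condition
          holds or some component violates it.\<close>
        also have "1 \<le> \<P>(\<omega> in M. \<forall>j\<in>S. - (t / z $ j) < Y n \<omega> $ j) +
            (\<Sum>j\<in>S. \<P>(\<omega> in M. Y n \<omega> $ j \<le> - (t / z $ j)))"
          using M.prob_le_add_sum[of "\<lambda>_. True" "\<lambda>\<omega>. \<forall>j\<in>S. - (t / z $ j) < Y n \<omega> $ j" S
              "\<lambda>j \<omega>. Y n \<omega> $ j \<le> - (t / z $ j)"]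
          by (fastforce simp: M.prob_space not_less)
        also have "(\<Sum>j\<in>S. \<P>(\<omega> in M. Y n \<omega> $ j \<le> - (t / z $ j))) \<le> (\<Sum>j\<in>S. exp (- (t / (2 * z $ j))))"
        proof (rule sum_mono)
          fix j
          show "\<P>(\<omega> in M. Y n \<omega> $ j \<le> - (t / z $ j)) \<le> exp (- (t / (2 * z $ j)))"
            using tail[of "t / z $ j" n j] z[of j] that by (simp add: mult.commute)
        qed
        finally show ?thesis by (simp add: add_increasing2)
      qed
      then show ?case unfolding p fst_conv snd_conv sum_eq by (auto split: split_indicator)
    qed
    show "(\<lambda>p. \<P>(\<omega> in M. snd p \<le> (MAX j. \<bar>inf x (Y n \<omega>) $ j\<bar> * fst p $ j)) * indicator {0<..} (snd p))
      \<in> borel_measurable (\<zeta> \<Otimes>\<^sub>M lborel)"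
      by (rule measurable_layer) (auto intro: M.prob_space_axioms)
  next
    show "(\<lambda>p. \<P>(\<omega> in N. snd p \<le> (MAX j. \<bar>inf x (\<eta> \<omega>) $ j\<bar> * fst p $ j)) * indicator {0<..} (snd p))
      \<in> borel_measurable (\<zeta> \<Otimes>\<^sub>M lborel)"
      by (rule measurable_layer) (auto intro: N.prob_space_axioms)
  qed
qed

text \<open>This keeps the denominator of the limit law away from 0: where the vector is at most
  \<open>- 1\<close>, \<open>D\<close> is at least 1. The comparison is made for \<open>Y n\<close>,
  whose integrability is known, and then passed to the limit.\<close>

lemma prob_le_expectation_D:
  "\<P>(\<omega> in N. \<eta> \<omega> \<le> - 1) \<le> (\<integral>\<omega>. D (inf 0 (\<eta> \<omega>)) \<partial>N)"
proof (rule LIMSEQ_le)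
  show "(\<lambda>n. \<P>(\<omega> in M. Y n \<omega> \<le> - 1)) \<longlonglongrightarrow> \<P>(\<omega> in N. \<eta> \<omega> \<le> - 1)"
    by (rule df_tendsto) (simp add: less_eq_vec_def)
  show "(\<lambda>n. \<integral>\<omega>. D (inf 0 (Y n \<omega>)) \<partial>M) \<longlonglongrightarrow> (\<integral>\<omega>. D (inf 0 (\<eta> \<omega>)) \<partial>N)"
    by (rule expectation_D_inf_tendsto) simp
  have "\<P>(\<omega> in M. Y n \<omega> \<le> - 1) \<le> (\<integral>\<omega>. D (inf 0 (Y n \<omega>)) \<partial>M)" for n
  proof -
    have "\<P>(\<omega> in M. Y n \<omega> \<le> - 1) = (\<integral>\<omega>. indicator {\<omega> \<in> space M. Y n \<omega> \<le> - 1} \<omega> \<partial>M)"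
      by simp
    also have "\<dots> \<le> (\<integral>\<omega>. D (inf 0 (Y n \<omega>)) \<partial>M)"
    proof (rule integral_mono)
      show "integrable M (\<lambda>\<omega>. D (inf 0 (Y n \<omega>)))"
        by (rule integrable_lipschitz_inf[OF D_lipschitz])
      fix \<omega>
      show "indicator {\<omega> \<in> space M. Y n \<omega> \<le> - 1} \<omega> \<le> D (inf 0 (Y n \<omega>))"
      proof (cases "Y n \<omega> \<le> - 1")
        case True
        then have "Y n \<omega> $ undefined \<le> - 1" by (simp add: less_eq_vec_def)
        then have "1 \<le> \<bar>inf 0 (Y n \<omega>) $ undefined\<bar>" by (simp add: inf_vec_def inf_real_def)
        also have "\<dots> \<le> D (inf 0 (Y n \<omega>))" by (rule component_le_D)
        finally show ?thesis by (auto split: split_indicator)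
      qed (simp add: D_nonneg)
    qed (auto intro!: integrable_real_indicator simp: M.emeasure_eq_measure)
    finally show ?thesis .
  qed
  then show "\<exists>k. \<forall>n\<ge>k. \<P>(\<omega> in M. Y n \<omega> \<le> - 1) \<le> (\<integral>\<omega>. D (inf 0 (Y n \<omega>)) \<partial>M)" by blast
qed

lemma expectation_equilipschitz_tendsto:
  fixes f :: "nat \<Rightarrow> real ^ 'd \<Rightarrow> real"
  assumes f: "\<And>n x y. \<bar>f n x - f n y\<bar> \<le> (\<Sum>j\<in>UNIV. \<bar>x $ j - y $ j\<bar>)"
    and lim: "\<And>x. x \<le> 0 \<Longrightarrow> (\<lambda>n. f n x) \<longlonglongrightarrow> D x"
    and "x \<le> 0"
  shows "(\<lambda>n. \<integral>\<omega>. f n (inf x (Y n \<omega>)) \<partial>M) \<longlonglongrightarrow> (\<integral>\<omega>. D (inf x (\<eta> \<omega>)) \<partial>N)"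
proof -
  have "(\<lambda>n. (\<integral>\<omega>. f n (inf x (Y n \<omega>)) - D (inf x (Y n \<omega>)) \<partial>M) + (\<integral>\<omega>. D (inf x (Y n \<omega>)) \<partial>M))
      \<longlonglongrightarrow> 0 + (\<integral>\<omega>. D (inf x (\<eta> \<omega>)) \<partial>N)"
    using expectation_diff_tendsto_0[OF f D_lipschitz lim \<open>x \<le> 0\<close>] expectation_D_inf_tendsto[OF \<open>x \<le> 0\<close>]
    by (intro tendsto_add)
  then show ?thesis
    using integrable_lipschitz_inf[OF f] integrable_lipschitz_inf[OF D_lipschitz] by simp
qed

end

section \<open>Copulas and records\<close>

text \<open>With \<open>s = 1 - c n\<close>, the bounds
  \<open>- s - 2 * s\<^sup>2 \<le> ln (1 - s) \<le> - s\<close> for \<open>s \<le> 1 / 2\<close>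
  show that \<open>n * s\<close> and \<open>- n * ln (1 - s)\<close> differ by at most
  \<open>2 * n * s\<^sup>2\<close>, hence by \<open>2 * B\<^sup>2 / n\<close>.\<close>

lemma tendsto_one_minus_of_power:
  fixes c :: "nat \<Rightarrow> real"
  assumes c: "\<And>n. 0 \<le> c n" "\<And>n. c n \<le> 1" and B: "\<And>n. real n * (1 - c n) \<le> B"
    and lim: "(\<lambda>n. c n ^ n) \<longlonglongrightarrow> exp (- a)"
  shows "(\<lambda>n. real n * (1 - c n)) \<longlonglongrightarrow> a"
proof -
  have "(\<lambda>n. - ln (c n ^ n)) \<longlonglongrightarrow> - ln (exp (- a))"
    by (intro tendsto_intros lim) simp
  moreover have "(\<lambda>n. real n * (1 - c n) - - ln (c n ^ n)) \<longlonglongrightarrow> 0"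
  proof (rule Lim_null_comparison)
    show "(\<lambda>n. 2 * B\<^sup>2 / real n) \<longlonglongrightarrow> 0" by real_asymp
    show "eventually (\<lambda>n. norm (real n * (1 - c n) - - ln (c n ^ n)) \<le> 2 * B\<^sup>2 / real n) sequentially"
      \<comment> \<open>From \<open>2 * B \<le> n\<close> follows \<open>s \<le> 1 / 2\<close>; the
        added 1 makes \<open>n\<close> positive.\<close>
      using eventually_ge_at_top[of "nat \<lceil>2 * B\<rceil> + 1"]
    proof eventually_elim
      case (elim n)
      then have n: "0 < real n" "2 * B \<le> real n" by linarith+
      define s where "s = 1 - c n"
      have s: "0 \<le> s" "real n * s \<le> B" "c n = 1 - s" using c B[of n] by (auto simp: s_def)
      have "real n * s \<le> real n * (1 / 2)" using s n by linarith
      then have "s \<le> 1 / 2" using n by (subst (asm) mult_le_cancel_left_pos) auto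
      then have pos: "0 < c n" using s by simp
      have ln_eq: "ln (c n ^ n) = real n * ln (1 - s)"
        using pos by (simp add: ln_realpow s(3))
      have "real n * (- s - 2 * s\<^sup>2) \<le> real n * ln (1 - s)"
        using ln_one_minus_pos_lower_bound[of s] s \<open>s \<le> 1 / 2\<close> by (intro mult_left_mono) auto
      moreover have "real n * ln (1 - s) \<le> real n * (- s)"
        using ln_le_minus_one[of "1 - s"] pos s by (intro mult_left_mono) auto
      moreover have "real n * s\<^sup>2 \<le> B\<^sup>2 / real n"
      proof -
        have "(real n * s)\<^sup>2 \<le> B\<^sup>2" using s n by (intro power_mono) auto
        then show ?thesis using n by (simp add: field_simps power2_eq_square)
      qed
      ultimately show ?case
        unfolding ln_eq unfolding s(3) by (simp add: abs_le_iff algebra_simps)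
    qed
  qed
  ultimately have "(\<lambda>n. (real n * (1 - c n) - - ln (c n ^ n)) + - ln (c n ^ n)) \<longlonglongrightarrow> 0 + - ln (exp (- a))"
    by (intro tendsto_add)
  then show ?thesis by simp
qed

text \<open>By independence the joint law is a product. For a fixed value \<open>w\<close> of
  \<open>W\<close>, the two inequalities merge into \<open>X \<omega> \<le> inf a w\<close>, which
  has probability \<open>F (inf a w)\<close>; it remains to integrate over \<open>w\<close>.\<close>

lemma (in prob_space) prob_le_indep_var:
  fixes X W :: "'a \<Rightarrow> real ^ 'd"
  assumes indep: "indep_var borel X borel W" and F: "\<And>v. \<P>(\<omega> in M. X \<omega> \<le> v) = F v"
    and [measurable]: "F \<in> borel_measurable borel"
  shows "\<P>(\<omega> in M. X \<omega> \<le> a \<and> X \<omega> \<le> W \<omega>) = (\<integral>\<omega>. F (inf a (W \<omega>)) \<partial>M)"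
proof -
  have [measurable]: "X \<in> borel_measurable M" "W \<in> borel_measurable M"
    and joint: "distr M borel X \<Otimes>\<^sub>M distr M borel W = distr M (borel \<Otimes>\<^sub>M borel) (\<lambda>\<omega>. (X \<omega>, W \<omega>))"
    using indep by (auto simp: indep_var_distribution_eq)
  interpret X: prob_space "distr M borel X" by (rule prob_space_distr) measurable
  interpret W: prob_space "distr M borel W" by (rule prob_space_distr) measurable
  interpret XW: pair_prob_space "distr M borel X" "distr M borel W" ..
  define A :: "((real ^ 'd) \<times> (real ^ 'd)) set" where "A = {p. fst p \<le> a \<and> fst p \<le> snd p}"
  have A [measurable]: "A \<in> sets (borel \<Otimes>\<^sub>M borel)"
  proof -
    have "A = {p \<in> space (borel \<Otimes>\<^sub>M borel). fst p \<le> a \<and> fst p \<le> snd p}"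
      by (auto simp: A_def space_pair_measure)
    also have "\<dots> \<in> sets (borel \<Otimes>\<^sub>M borel)" by measurable
    finally show ?thesis .
  qed
  have F_nonneg: "0 \<le> F v" for v using F[of v] by (metis measure_nonneg)
  have "emeasure M {\<omega> \<in> space M. X \<omega> \<le> a \<and> X \<omega> \<le> W \<omega>} =
      emeasure (distr M (borel \<Otimes>\<^sub>M borel) (\<lambda>\<omega>. (X \<omega>, W \<omega>))) A"
    by (subst emeasure_distr[OF _ A]) (measurable, auto simp: A_def intro!: arg_cong[where f="emeasure M"])
  also have "\<dots> = (\<integral>\<^sup>+w. emeasure (distr M borel X) ((\<lambda>x. (x, w)) -` A) \<partial>distr M borel W)"
    unfolding joint[symmetric] by (rule XW.emeasure_pair_measure_alt2) simp
  also have "\<dots> = (\<integral>\<^sup>+w. ennreal (F (inf a w)) \<partial>distr M borel W)"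
  proof (rule nn_integral_cong)
    fix w
    have "emeasure (distr M borel X) ((\<lambda>x. (x, w)) -` A) = emeasure M {\<omega> \<in> space M. X \<omega> \<le> inf a w}"
    proof -
      have "((\<lambda>x. (x, w)) -` A) = {x \<in> space borel. x \<le> inf a w}" by (auto simp: A_def)
      also have "\<dots> \<in> sets borel" by measurable
      finally show ?thesis
        by (subst emeasure_distr) (auto simp: A_def intro!: arg_cong[where f="emeasure M"])
    qed
    then show "emeasure (distr M borel X) ((\<lambda>x. (x, w)) -` A) = ennreal (F (inf a w))"
      by (simp only: emeasure_eq_measure F)
  qed
  also have "\<dots> = (\<integral>\<^sup>+\<omega>. ennreal (F (inf a (W \<omega>))) \<partial>M)"
    by (intro nn_integral_distr) measurable
  finally have "measure M {\<omega> \<in> space M. X \<omega> \<le> a \<and> X \<omega> \<le> W \<omega>} =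
      enn2real (\<integral>\<^sup>+\<omega>. ennreal (F (inf a (W \<omega>))) \<partial>M)"
    by (simp add: measure_def)
  then show ?thesis
    by (subst integral_eq_nn_integral) (auto simp: F_nonneg)
qed

section \<open>Bounds and limits for a copula from its uniform margins\<close>

locale copula_law = prob_space \<mu>
  for \<mu> :: "(real ^ 'd) measure" +
  fixes C :: "real ^ 'd \<Rightarrow> real"
  assumes sets_law [measurable_cong]: "sets \<mu> = sets borel"
    and C_eq: "C x = \<P>(u in \<mu>. u \<le> x)"
    and margin: "distr \<mu> borel (\<lambda>u. u $ j) = uniform_measure lborel {0<..<1}"
begin

lemma prob_component:
  assumes [measurable]: "S \<in> sets borel"
  shows "\<P>(u in \<mu>. u $ j \<in> S) = measure lborel ({0<..<1} \<inter> S)"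
proof -
  have "\<P>(u in \<mu>. u $ j \<in> S) = measure (distr \<mu> borel (\<lambda>u. u $ j)) S"
    by (subst measure_distr) (auto intro!: arg_cong[where f="measure \<mu>"])
  then show ?thesis by (simp add: margin)
qed

lemma prob_component_between_le: "\<P>(u in \<mu>. a < u $ j \<and> u $ j \<le> b) \<le> \<bar>b - a\<bar>"
proof -
  have "\<P>(u in \<mu>. a < u $ j \<and> u $ j \<le> b) = measure lborel ({0<..<1} \<inter> {a<..b})"
    using prob_component[of "{a<..b}" j] by simp
  also have "\<dots> \<le> \<bar>b - a\<bar>"
  proof (cases "a \<le> b")
    case True
    have "measure lborel ({0<..<1} \<inter> {a<..b}) \<le> measure lborel {a<..b}"
      using True by (intro measure_mono_fmeasurable) (auto simp: fmeasurable_def)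
    with True show ?thesis by simp
  qed simp
  finally show ?thesis .
qed

lemma C_nonneg: "0 \<le> C x" and C_le_1: "C x \<le> 1"
  by (simp_all add: C_eq)

text \<open>Dropping all but one component leaves a uniform margin. This bound is the source of the
  exponential tails of the maxima.\<close>

lemma C_le_component: "C x \<le> max 0 (x $ j)"
proof -
  have "C x \<le> \<P>(u in \<mu>. u $ j \<in> {..x $ j})"
    unfolding C_eq by (intro finite_measure_mono) (auto simp: less_eq_vec_def)
  also have "\<dots> = measure lborel ({0<..<1} \<inter> {..x $ j})" by (rule prob_component) simp
  also have "\<dots> \<le> measure lborel {0<..max 0 (x $ j)}"
    by (intro measure_mono_fmeasurable) (auto simp: fmeasurable_def)
  finally show ?thesis by simp
qed

lemma C_one: "C 1 = 1"
proof -
  have "AE u in \<mu>. u $ j \<le> 1" for j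
  proof -
    have "AE r in distr \<mu> borel (\<lambda>u. u $ j). r \<le> 1"
      unfolding margin by (rule AE_uniform_measureI) auto
    then show ?thesis by (subst (asm) AE_distr_iff) auto
  qed
  then have "AE u in \<mu>. \<forall>j\<in>UNIV. u $ j \<le> 1"
    by (intro AE_finite_allI) auto
  then have "AE u in \<mu>. u \<le> 1" by (simp add: less_eq_vec_def)
  then show ?thesis unfolding C_eq by (subst prob_Collect_eq_1) auto
qed

text \<open>If \<open>u \<le> x\<close> but not \<open>u \<le> y\<close>, some component of
  \<open>u\<close> lies between \<open>y $ j\<close> and \<open>x $ j\<close>, which a uniform
  margin allows with probability at most the distance.\<close>

lemma C_diff_le: "C x - C y \<le> (\<Sum>j\<in>UNIV. \<bar>x $ j - y $ j\<bar>)"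
proof -
  have "C x \<le> C y + (\<Sum>j\<in>UNIV. \<P>(u in \<mu>. y $ j < u $ j \<and> u $ j \<le> x $ j))"
    unfolding C_eq by (rule prob_le_add_sum) (auto simp: less_eq_vec_def not_le)
  also have "(\<Sum>j\<in>UNIV. \<P>(u in \<mu>. y $ j < u $ j \<and> u $ j \<le> x $ j)) \<le> (\<Sum>j\<in>UNIV. \<bar>x $ j - y $ j\<bar>)"
    by (intro sum_mono prob_component_between_le)
  finally show ?thesis by simp
qed

lemma C_lipschitz: "\<bar>C x - C y\<bar> \<le> (\<Sum>j\<in>UNIV. \<bar>x $ j - y $ j\<bar>)"
  using C_diff_le[of x y] C_diff_le[of y x] by (simp add: abs_le_iff abs_minus_commute)

lemma C_measurable [measurable]: "C \<in> borel_measurable borel"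
  using C_lipschitz by (intro borel_measurable_of_lipschitz[where L=1]) simp

text \<open>The outer factor \<open>m\<close> cancels the inner \<open>1 / m\<close>, so the
  constant 1 is the same for every scale. This equicontinuity upgrades pointwise to uniform
  convergence.\<close>

lemma scaled_lipschitz:
  assumes "0 < m"
  shows "\<bar>m * (1 - C (1 + x /\<^sub>R m)) - m * (1 - C (1 + y /\<^sub>R m))\<bar> \<le> (\<Sum>j\<in>UNIV. \<bar>x $ j - y $ j\<bar>)"
proof -
  have "\<bar>m * (1 - C (1 + x /\<^sub>R m)) - m * (1 - C (1 + y /\<^sub>R m))\<bar> =
      m * \<bar>C (1 + x /\<^sub>R m) - C (1 + y /\<^sub>R m)\<bar>"
    using assms by (simp add: right_diff_distrib[symmetric] abs_mult abs_minus_commute)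
  also have "\<dots> \<le> m * (\<Sum>j\<in>UNIV. \<bar>(1 + x /\<^sub>R m) $ j - (1 + y /\<^sub>R m) $ j\<bar>)"
    using assms by (intro mult_left_mono C_lipschitz) auto
  also have "\<dots> = (\<Sum>j\<in>UNIV. \<bar>x $ j - y $ j\<bar>)"
    unfolding sum_distrib_left
  proof (rule sum.cong[OF refl])
    fix j
    have "(1 + x /\<^sub>R m) $ j - (1 + y /\<^sub>R m) $ j = (x $ j - y $ j) / m"
      by (simp add: divide_inverse algebra_simps)
    then show "m * \<bar>(1 + x /\<^sub>R m) $ j - (1 + y /\<^sub>R m) $ j\<bar> = \<bar>x $ j - y $ j\<bar>"
      using assms by (simp add: abs_divide)
  qed
  finally show ?thesis .
qed

lemma scaled_le: "real n * (1 - C (1 + x /\<^sub>R real n)) \<le> (\<Sum>j\<in>UNIV. \<bar>x $ j\<bar>)"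
  using scaled_lipschitz[of "real n" x 0] by (cases "n = 0") (auto simp: C_one sum_nonneg)

lemma scaled_tendsto:
  assumes "(\<lambda>n. C (1 + x /\<^sub>R real n) ^ n) \<longlonglongrightarrow> exp (- a)"
  shows "(\<lambda>n. real n * (1 - C (1 + x /\<^sub>R real n))) \<longlonglongrightarrow> a"
  by (rule tendsto_one_minus_of_power[OF C_nonneg C_le_1 scaled_le assms])

text \<open>A maximum preceding observation \<open>n + 2\<close> involves \<open>n + 1\<close>
  observations, one factor fewer than the scale suggests. The missing factor tends to 1 and may be
  divided out.\<close>

lemma power_pred_tendsto:
  assumes "(\<lambda>n. C (1 + x /\<^sub>R real n) ^ n) \<longlonglongrightarrow> a"
  shows "(\<lambda>n. C (1 + x /\<^sub>R real (n + 2)) ^ (n + 1)) \<longlonglongrightarrow> a"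
proof -
  define c where "c n = C (1 + x /\<^sub>R real (n + 2))" for n
  have "(\<lambda>n. c n - 1) \<longlonglongrightarrow> 0"
  proof (rule Lim_null_comparison)
    have "(\<lambda>n. s / real (n + 2)) \<longlonglongrightarrow> 0" for s :: real by real_asymp
    then show "(\<lambda>n. (\<Sum>j\<in>UNIV. \<bar>x $ j\<bar>) / real (n + 2)) \<longlonglongrightarrow> 0" .
    show "eventually (\<lambda>n. norm (c n - 1) \<le> (\<Sum>j\<in>UNIV. \<bar>x $ j\<bar>) / real (n + 2)) sequentially"
    proof (rule always_eventually, rule allI)
      fix n
      show "norm (c n - 1) \<le> (\<Sum>j\<in>UNIV. \<bar>x $ j\<bar>) / real (n + 2)"
        using scaled_le[of "n + 2" x] C_le_1[of "1 + x /\<^sub>R real (n + 2)"]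
        by (simp add: c_def pos_le_divide_eq mult.commute del: of_nat_add)
    qed
  qed
  then have c1: "c \<longlonglongrightarrow> 1" by (simp add: LIM_zero_iff)
  moreover have "(\<lambda>n. c n ^ (n + 2)) \<longlonglongrightarrow> a"
    using LIMSEQ_ignore_initial_segment[OF assms, of 2] by (simp add: c_def)
  ultimately have "(\<lambda>n. c n ^ (n + 2) / c n) \<longlonglongrightarrow> a / 1" by (intro tendsto_divide) auto
  moreover have "eventually (\<lambda>n. 0 < c n) sequentially"
    using order_tendstoD(1)[OF c1, of 0] by simp
  then have "eventually (\<lambda>n. c n ^ (n + 2) / c n = c n ^ (n + 1)) sequentially"
    by eventually_elim simp
  ultimately show ?thesis
    by (simp add: tendsto_cong c_def)
qed

end

text \<open>The index is shifted by two, so that the maximum runs over a nonempty set.\<close>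

definition scaled_max :: "(nat \<Rightarrow> 'a \<Rightarrow> real ^ 'd) \<Rightarrow> nat \<Rightarrow> 'a \<Rightarrow> real ^ 'd" where
  "scaled_max Us n \<omega> = real (n + 2) *\<^sub>R ((\<chi> j. MAX i\<in>{1..<n + 2}. Us i \<omega> $ j) - 1)"

lemma scaled_le_iff:
  fixes u y :: "real ^ 'd"
  assumes "0 < m"
  shows "m *\<^sub>R (u - 1) \<le> y \<longleftrightarrow> u \<le> 1 + y /\<^sub>R m"
proof -
  have "m * (u $ j - 1) \<le> y $ j \<longleftrightarrow> u $ j \<le> 1 + inverse m * y $ j" for j
    using assms by (simp add: field_simps)
  then show ?thesis by (simp add: less_eq_vec_def)
qed

lemma scaled_max_le_iff:
  "scaled_max Us n \<omega> \<le> y \<longleftrightarrow> (\<forall>i\<in>{1..<n + 2}. Us i \<omega> \<le> 1 + y /\<^sub>R real (n + 2))"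
proof -
  have "(\<chi> j. MAX i\<in>{1..<n + 2}. Us i \<omega> $ j) \<le> v \<longleftrightarrow> (\<forall>i\<in>{1..<n + 2}. Us i \<omega> \<le> v)" for v
    by (auto simp: less_eq_vec_def)
  then show ?thesis
    unfolding scaled_max_def by (subst scaled_le_iff) auto
qed

text \<open>The affine rescaling is increasing in each component and therefore commutes with the
  componentwise minimum.\<close>

lemma inf_scaled:
  fixes x w :: "real ^ 'd"
  assumes "0 < m"
  shows "1 + inf x (m *\<^sub>R (w - 1)) /\<^sub>R m = inf (1 + x /\<^sub>R m) w"
proof -
  have "1 + inverse m * min a (m * (b - 1)) = min (1 + inverse m * a) b" for a b :: real
    using assms by (auto simp: min_def field_simps)
  then show ?thesis by (simp add: vec_eq_iff inf_vec_def inf_real_def)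
qed

section \<open>Maxima and records of an independent sample\<close>

locale copula_sample = M: prob_space M + copula_law \<mu> C
  for M :: "'a measure" and \<mu> :: "(real ^ 'd) measure" and C +
  fixes Us :: "nat \<Rightarrow> 'a \<Rightarrow> real ^ 'd"
  assumes indep: "M.indep_vars (\<lambda>_. borel) Us {1..}"
    and df: "1 \<le> i \<Longrightarrow> \<P>(\<omega> in M. Us i \<omega> \<le> x) = C x"
begin

lemma Us_measurable: "1 \<le> i \<Longrightarrow> Us i \<in> borel_measurable M"
  using indep unfolding M.indep_vars_def by auto

lemma scaled_max_measurable [measurable]: "scaled_max Us n \<in> borel_measurable M"
proof -
  have [measurable]: "Us i \<in> borel_measurable M" if "i \<in> {1..<n + 2}" for i
    using that by (intro Us_measurable) auto
  show ?thesis unfolding scaled_max_def by measurable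
qed

lemma scaled_max_df:
  "\<P>(\<omega> in M. scaled_max Us n \<omega> \<le> y) = C (1 + y /\<^sub>R real (n + 2)) ^ (n + 1)"
proof -
  let ?a = "1 + y /\<^sub>R real (n + 2)" and ?J = "{1..<n + 2}"
  have meas: "{v. v \<le> ?a} \<in> sets borel"
  proof -
    have "{v \<in> space borel. v \<le> ?a} \<in> sets borel" by measurable
    then show ?thesis by simp
  qed
  have "{\<omega> \<in> space M. scaled_max Us n \<omega> \<le> y} = (\<Inter>i\<in>?J. Us i -` {v. v \<le> ?a} \<inter> space M)"
    by (auto simp: scaled_max_le_iff simp del: of_nat_add)
  also have "measure M \<dots> = (\<Prod>i\<in>?J. measure M (Us i -` {v. v \<le> ?a} \<inter> space M))"
    using meas by (intro M.indep_varsD[OF indep]) auto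
  also have "\<dots> = (\<Prod>i\<in>?J. C ?a)"
  proof (rule prod.cong[OF refl])
    fix i assume "i \<in> ?J"
    then have "measure M {\<omega> \<in> space M. Us i \<omega> \<le> ?a} = C ?a" by (intro df) auto
    then show "measure M (Us i -` {v. v \<le> ?a} \<inter> space M) = C ?a"
      by (simp add: vimage_def Int_def conj_commute)
  qed
  finally show ?thesis by simp
qed

lemma scaled_max_nonpos: "AE \<omega> in M. scaled_max Us n \<omega> \<le> 0"
proof -
  have "\<P>(\<omega> in M. scaled_max Us n \<omega> \<le> 0) = 1" by (simp only: scaled_max_df) (simp add: C_one)
  then show ?thesis by (subst (asm) M.prob_Collect_eq_1) auto
qed

text \<open>One component of a nonpositive vector is controlled by the distribution function at a
  point that is 0 elsewhere. There the margin bound and \<open>1 - s \<le> exp (- s)\<close> apply,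
  and the exponent \<open>n + 1\<close> against the scale \<open>n + 2\<close> costs at most a
  factor 1/2 in the rate.\<close>

lemma scaled_max_tail:
  assumes "0 \<le> t"
  shows "\<P>(\<omega> in M. scaled_max Us n \<omega> $ j \<le> - t) \<le> exp (- (t / 2))"
proof -
  define y :: "real ^ 'd" where "y = (\<chi> i. if i = j then - t else 0)"
  let ?m = "real (n + 2)"
  have le_iff: "v \<le> y \<longleftrightarrow> v $ j \<le> - t" if "v \<le> 0" for v
    using that by (auto simp: y_def less_eq_vec_def)
  have "\<P>(\<omega> in M. scaled_max Us n \<omega> $ j \<le> - t) = \<P>(\<omega> in M. scaled_max Us n \<omega> \<le> y)"
    using scaled_max_nonpos[of n] by (intro M.prob_eq_AE) (auto simp: le_iff)
  also have "\<dots> = C (1 + y /\<^sub>R ?m) ^ (n + 1)" by (rule scaled_max_df)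
  also have "\<dots> \<le> exp (- (t / ?m)) ^ (n + 1)"
  proof (rule power_mono[OF _ C_nonneg])
    have "C (1 + y /\<^sub>R ?m) \<le> max 0 ((1 + y /\<^sub>R ?m) $ j)" by (rule C_le_component)
    also have "(1 + y /\<^sub>R ?m) $ j = 1 + - (t / ?m)" by (simp add: y_def divide_inverse)
    also have "max 0 (1 + - (t / ?m)) \<le> exp (- (t / ?m))"
      using exp_ge_add_one_self[of "- (t / ?m)"] by auto
    finally show "C (1 + y /\<^sub>R ?m) \<le> exp (- (t / ?m))" .
  qed
  also have "\<dots> = exp (- (t * (real (n + 1) / ?m)))"
    unfolding exp_of_nat_mult[symmetric] by simp
  also have "\<dots> \<le> exp (- (t / 2))"
  proof -
    have "1 / 2 \<le> real (n + 1) / ?m" by (simp add: field_simps)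
    from mult_left_mono[OF this assms] show ?thesis by simp
  qed
  finally show ?thesis .
qed

text \<open>Being a record means not lying below the maximum \<open>W\<close> of the predecessors,
  so the probability is \<open>C ?a\<close> minus the expectation of
  \<open>C (inf ?a (W \<omega>))\<close>. Subtracting both terms from 1 gives the scaled form, whose
  limit is \<open>D\<close>.\<close>

lemma scaled_record_prob:
  fixes n x
  defines "m \<equiv> real (n + 2)"
  shows "m * \<P>(\<omega> in M. m *\<^sub>R (Us (n + 2) \<omega> - 1) \<le> x \<and> simple_record Us (n + 2) \<omega>) =
    (\<integral>\<omega>. m * (1 - C (1 + inf x (scaled_max Us n \<omega>) /\<^sub>R m)) \<partial>M) - m * (1 - C (1 + x /\<^sub>R m))"
proof -
  let ?X = "Us (n + 2)" and ?a = "1 + x /\<^sub>R m" and ?J = "{1..<n + 2}"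
  define W where "W \<omega> = (\<chi> j. MAX i\<in>?J. Us i \<omega> $ j)" for \<omega>
  have m: "0 < m" by (simp add: m_def)
  have [measurable]: "?X \<in> borel_measurable M" by (rule Us_measurable) simp
  \<comment> \<open>The new observation and \<open>W\<close> are functions of disjoint blocks of the
    independent sequence.\<close>
  have "M.indep_var borel ((\<lambda>f. f (n + 2)) \<circ> (\<lambda>\<omega>. restrict (\<lambda>i. Us i \<omega>) {n + 2}))
      borel ((\<lambda>f. \<chi> j. MAX i\<in>?J. f i $ j) \<circ> (\<lambda>\<omega>. restrict (\<lambda>i. Us i \<omega>) ?J))"
    by (intro M.indep_var_compose[OF M.indep_var_restrict[OF indep]]) auto
  also have "(\<lambda>f. f (n + 2)) \<circ> (\<lambda>\<omega>. restrict (\<lambda>i. Us i \<omega>) {n + 2}) = ?X" by auto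
  also have "(\<lambda>f. \<chi> j. MAX i\<in>?J. f i $ j) \<circ> (\<lambda>\<omega>. restrict (\<lambda>i. Us i \<omega>) ?J) = W"
    by (auto simp: W_def fun_eq_iff cong: image_cong_simp)
  finally have XW: "M.indep_var borel ?X borel W" .
  then have [measurable]: "W \<in> borel_measurable M" by (rule M.indep_var_rv2)
  have record_iff: "simple_record Us (n + 2) \<omega> \<longleftrightarrow> \<not> ?X \<omega> \<le> W \<omega>" for \<omega>
    unfolding W_def by (rule simple_record_iff_not_le_Max) simp
  have "\<P>(\<omega> in M. m *\<^sub>R (?X \<omega> - 1) \<le> x \<and> simple_record Us (n + 2) \<omega>) =
      measure M ({\<omega> \<in> space M. ?X \<omega> \<le> ?a} - {\<omega> \<in> space M. ?X \<omega> \<le> ?a \<and> ?X \<omega> \<le> W \<omega>})"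
    unfolding record_iff scaled_le_iff[OF m] by (intro arg_cong[where f="measure M"]) auto
  also have "\<dots> = \<P>(\<omega> in M. ?X \<omega> \<le> ?a) - \<P>(\<omega> in M. ?X \<omega> \<le> ?a \<and> ?X \<omega> \<le> W \<omega>)"
    by (intro M.finite_measure_Diff) (measurable, auto)
  also have "\<dots> = C ?a - (\<integral>\<omega>. C (inf ?a (W \<omega>)) \<partial>M)"
    using df[of "n + 2"] by (subst M.prob_le_indep_var[OF XW, where F=C]) auto
  finally have 1: "\<P>(\<omega> in M. m *\<^sub>R (?X \<omega> - 1) \<le> x \<and> simple_record Us (n + 2) \<omega>) =
      C ?a - (\<integral>\<omega>. C (inf ?a (W \<omega>)) \<partial>M)" .
  have "integrable M (\<lambda>\<omega>. C (inf ?a (W \<omega>)))"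
    by (intro M.integrable_const_bound[where B=1]) (auto simp: C_nonneg C_le_1)
  then have 2: "(\<integral>\<omega>. m * (1 - C (inf ?a (W \<omega>))) \<partial>M) = m * (1 - (\<integral>\<omega>. C (inf ?a (W \<omega>)) \<partial>M))"
    by (simp add: M.prob_space)
  have 3: "1 + inf x (scaled_max Us n \<omega>) /\<^sub>R m = inf ?a (W \<omega>)" for \<omega>
    unfolding scaled_max_def m_def[symmetric] W_def[symmetric] by (rule inf_scaled[OF m])
  show ?thesis unfolding 1 2 3 by (simp add: algebra_simps)
qed

text \<open>Observations are almost surely at most 1, so the condition at \<open>x = 0\<close> costs
  nothing and the record probability becomes a case of \<open>scaled_record_prob\<close>.\<close>

lemma record_prob_eq:
  "simple_record_prob M Us (n + 2) =
    \<P>(\<omega> in M. real (n + 2) *\<^sub>R (Us (n + 2) \<omega> - 1) \<le> 0 \<and> simple_record Us (n + 2) \<omega>)"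
proof -
  have [measurable]: "Us i \<in> borel_measurable M" if "i \<in> {1..<n + 2}" for i
    using that by (intro Us_measurable) auto
  have [measurable]: "Us (n + 2) \<in> borel_measurable M" by (rule Us_measurable) simp
  have meas: "{\<omega> \<in> space M. Us (n + 2) \<omega> \<le> 1} \<in> sets M" by measurable
  have "\<P>(\<omega> in M. Us (n + 2) \<omega> \<le> 1) = 1" using df[of "n + 2" 1] by (simp add: C_one)
  then have "AE \<omega> in M. Us (n + 2) \<omega> \<le> 1" unfolding M.prob_Collect_eq_1[OF meas] .
  then show ?thesis
    unfolding simple_record_prob_def
  proof (intro M.prob_eq_AE)
    show "{\<omega> \<in> space M. simple_record Us (n + 2) \<omega>} \<in> sets M"
      unfolding simple_record_def by measurable
    show "{\<omega> \<in> space M. real (n + 2) *\<^sub>R (Us (n + 2) \<omega> - 1) \<le> 0 \<and> simple_record Us (n + 2) \<omega>} \<in> sets M"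
      unfolding simple_record_def by measurable
  qed (auto simp: scaled_le_iff simp del: of_nat_add elim!: eventually_mono)
qed

end

theorem theorem4p1:
  fixes M :: "'a measure" and Us :: "nat \<Rightarrow> 'a \<Rightarrow> real ^ 'd"
    and K :: "'b measure" and U :: "'b \<Rightarrow> real ^ 'd"
    and N :: "'c measure" and \<eta> :: "'c \<Rightarrow> real ^ 'd"
    and C D :: "real ^ 'd \<Rightarrow> real"
  assumes "prob_space M" and "prob_space K" and "prob_space N"
    and "copula C" and "has_df K U C"
    and "prob_space.indep_vars M (\<lambda>_. borel) Us {1..}"
    and "\<And>i. i \<ge> 1 \<Longrightarrow> distr M borel (Us i) = distr K borel U"
    and "D_norm D" and "C \<in> max_domain (max_stable_df D)"
    and "has_df N \<eta> (max_stable_df D)"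
  shows "(\<lambda>n. real n * simple_record_prob M Us n) \<longlonglongrightarrow> (\<integral>\<omega>. D (\<eta> \<omega>) \<partial>N) \<and>
    (\<forall>x\<le>0. (\<lambda>n. \<P>(\<omega> in M. real n *\<^sub>R (Us n \<omega> - 1) \<le> x \<bar> simple_record Us n \<omega>))
           \<longlonglongrightarrow> ((\<integral>\<omega>. D (inf x (\<eta> \<omega>)) \<partial>N) - D x) / (\<integral>\<omega>. D (\<eta> \<omega>) \<partial>N))"
proof -
  interpret M: prob_space M by fact
  interpret N: prob_space N by fact
  obtain \<mu> where \<mu>: "prob_space \<mu>" "sets \<mu> = sets borel" "\<And>x. \<P>(u in \<mu>. u \<le> x) = C x"
      "\<And>j. distr \<mu> borel (\<lambda>u. u $ j) = uniform_measure lborel {0<..<1}"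
    using \<open>copula C\<close> by (auto simp: copula_def has_df_def)
  obtain \<zeta> where "D_norm_generator \<zeta> D"
    using \<open>D_norm D\<close> by (auto simp: D_norm_def D_norm_generator_def D_norm_generator_axioms_def)
  interpret D: D_norm_generator \<zeta> D by fact
  interpret C: copula_law \<mu> C
    by (intro copula_law.intro copula_law_axioms.intro) (simp_all add: \<mu>)
  have [measurable]: "U \<in> borel_measurable K" "\<eta> \<in> borel_measurable N"
    and U_df: "\<P>(\<omega> in K. U \<omega> \<le> x) = C x" and \<eta>_df: "\<P>(\<omega> in N. \<eta> \<omega> \<le> x) = max_stable_df D x" for x
    using assms(5,10) by (auto simp: has_df_def)
  have df: "\<P>(\<omega> in M. Us i \<omega> \<le> x) = C x" if "1 \<le> i" for i x
  proof -
    have [measurable]: "Us i \<in> borel_measurable M"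
      using assms(6) that unfolding M.indep_vars_def by auto
    have meas: "{v. v \<le> x} \<in> sets borel"
    proof -
      have "{v \<in> space borel. v \<le> x} \<in> sets borel" by measurable
      then show ?thesis by simp
    qed
    have "measure (distr M borel (Us i)) {v. v \<le> x} = measure (distr K borel U) {v. v \<le> x}"
      by (simp only: assms(7)[OF that])
    with meas U_df[of x] show ?thesis
      by (simp add: measure_distr vimage_def Int_def conj_commute)
  qed
  interpret S: copula_sample M \<mu> C Us
    by (intro copula_sample.intro copula_sample_axioms.intro M.prob_space_axioms C.copula_law_axioms
        assms(6) df)
  have G: "(\<lambda>n. C (1 + x /\<^sub>R real n) ^ n) \<longlonglongrightarrow> exp (- D x)" if "x \<le> 0" for x
    using assms(9) that by (auto simp: max_domain_def max_stable_df_def inf_absorb1)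
  have \<eta>_df': "\<P>(\<omega> in N. \<eta> \<omega> \<le> x) = exp (- D x)" if "x \<le> 0" for x
    using that by (simp add: \<eta>_df max_stable_df_def inf_absorb1)
  have "{\<omega> \<in> space N. \<eta> \<omega> \<le> 0} \<in> sets N" by measurable
  \<comment> \<open>The distribution function at 0 is \<open>exp (- D 0) = 1\<close>.\<close>
  then have \<eta>_nonpos: "AE \<omega> in N. \<eta> \<omega> \<le> 0"
    using \<eta>_df'[of 0] by (simp add: N.prob_Collect_eq_1[symmetric])
  interpret L: D_norm_nonpos_limit M N "scaled_max Us" \<eta> \<zeta> D
  proof (intro D_norm_nonpos_limit.intro nonpos_df_limit.intro nonpos_df_limit_axioms.intro
      M.prob_space_axioms N.prob_space_axioms D.D_norm_generator_axioms
      S.scaled_max_measurable S.scaled_max_nonpos S.scaled_max_tail \<eta>_nonpos)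
    show "(\<lambda>n. \<P>(\<omega> in M. scaled_max Us n \<omega> \<le> y)) \<longlonglongrightarrow> \<P>(\<omega> in N. \<eta> \<omega> \<le> y)" if "y \<le> 0" for y
      using C.power_pred_tendsto[OF G[OF that]] by (simp only: S.scaled_max_df \<eta>_df'[OF that])
  qed fact
  define h where "h n x = real (n + 2) * (1 - C (1 + x /\<^sub>R real (n + 2)))" for n x
  have h_lipschitz: "\<bar>h n x - h n y\<bar> \<le> (\<Sum>j\<in>UNIV. \<bar>x $ j - y $ j\<bar>)" for n x y
    unfolding h_def by (rule C.scaled_lipschitz) simp
  have h_tendsto: "(\<lambda>n. h n x) \<longlonglongrightarrow> D x" if "x \<le> 0" for x
    unfolding h_def
    by (rule LIMSEQ_ignore_initial_segment[OF C.scaled_tendsto[OF G[OF that]]])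
  define p where "p n x = \<P>(\<omega> in M. real n *\<^sub>R (Us n \<omega> - 1) \<le> x \<and> simple_record Us n \<omega>)" for n x
  have p_tendsto: "(\<lambda>n. real n * p n x) \<longlonglongrightarrow> (\<integral>\<omega>. D (inf x (\<eta> \<omega>)) \<partial>N) - D x" if "x \<le> 0" for x
  proof (rule LIMSEQ_offset[where k=2])
    have "(\<lambda>n. (\<integral>\<omega>. h n (inf x (scaled_max Us n \<omega>)) \<partial>M) - h n x) \<longlonglongrightarrow>
        (\<integral>\<omega>. D (inf x (\<eta> \<omega>)) \<partial>N) - D x"
      using L.expectation_equilipschitz_tendsto[OF h_lipschitz h_tendsto that] h_tendsto[OF that]
      by (rule tendsto_diff)
    then show "(\<lambda>n. real (n + 2) * p (n + 2) x) \<longlonglongrightarrow> (\<integral>\<omega>. D (inf x (\<eta> \<omega>)) \<partial>N) - D x"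
      unfolding p_def S.scaled_record_prob h_def .
  qed
  have D_inf_0: "(\<integral>\<omega>. D (inf 0 (\<eta> \<omega>)) \<partial>N) = (\<integral>\<omega>. D (\<eta> \<omega>) \<partial>N)"
    using \<eta>_nonpos by (intro integral_cong_AE) (auto simp: inf_absorb2)
  have record_tendsto: "(\<lambda>n. real n * simple_record_prob M Us n) \<longlonglongrightarrow> (\<integral>\<omega>. D (\<eta> \<omega>) \<partial>N)"
  proof (rule LIMSEQ_offset[where k=2])
    show "(\<lambda>n. real (n + 2) * simple_record_prob M Us (n + 2)) \<longlonglongrightarrow> (\<integral>\<omega>. D (\<eta> \<omega>) \<partial>N)"
      using LIMSEQ_ignore_initial_segment[OF p_tendsto[of 0], of 2]
      unfolding p_def S.record_prob_eq[symmetric] D_inf_0 by simp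
  qed
  have "0 < exp (- D (- 1))" by simp
  also have "\<dots> \<le> (\<integral>\<omega>. D (\<eta> \<omega>) \<partial>N)"
    using L.prob_le_expectation_D \<eta>_df'[of "- 1"] by (simp add: D_inf_0 less_eq_vec_def)
  finally have pos: "(\<integral>\<omega>. D (\<eta> \<omega>) \<partial>N) \<noteq> 0" by simp
  have "(\<lambda>n. \<P>(\<omega> in M. real n *\<^sub>R (Us n \<omega> - 1) \<le> x \<bar> simple_record Us n \<omega>))
      \<longlonglongrightarrow> ((\<integral>\<omega>. D (inf x (\<eta> \<omega>)) \<partial>N) - D x) / (\<integral>\<omega>. D (\<eta> \<omega>) \<partial>N)" if "x \<le> 0" for x
  \<comment> \<open>The conditional probability is a quotient; expanding it by \<open>n > 0\<close>
    turns numerator and denominator into the two convergent sequences.\<close>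
  proof (rule Lim_transform_eventually)
    show "(\<lambda>n. (real n * p n x) / (real n * simple_record_prob M Us n)) \<longlonglongrightarrow>
        ((\<integral>\<omega>. D (inf x (\<eta> \<omega>)) \<partial>N) - D x) / (\<integral>\<omega>. D (\<eta> \<omega>) \<partial>N)"
      by (intro tendsto_divide p_tendsto[OF that] record_tendsto pos)
    show "eventually (\<lambda>n. (real n * p n x) / (real n * simple_record_prob M Us n) =
        \<P>(\<omega> in M. real n *\<^sub>R (Us n \<omega> - 1) \<le> x \<bar> simple_record Us n \<omega>)) sequentially"
      using eventually_gt_at_top[of 0]
      by eventually_elim (simp add: p_def simple_record_prob_def cond_prob_def)
  qed
  with record_tendsto show ?thesis by blast
qed

end
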